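(* Let $X$ be a set and $\Lambda$ a uniform Banach space. A function $K:X\times X\to\mathcal{M}(\Lambda)$ is the reproducing kernel of some $\Lambda$-valued RKBS on $X$ if and only if there exist a uniform Banach space $\mathcal{W}$ and a mapping $\Phi:X\to\mathcal{L}(\mathcal{W},\Lambda)$ such that $$K(x,y)=\Phi(y)\Phi^\dag(x),\quad x,y\in X,$$ and $$\overline{\operatorname{span}}\{(\Phi^\dag(x)\xi)^*:x\in X,\ \xi\in\Lambda\}=\mathcal{W}^*.$$ Here $\Phi^\dag:X\to\mathcal{M}(\Lambda,\mathcal{W})$ is defined by $\Phi^\dag(x):=(\Phi(x))^\dag$, the generalized adjoint of $\Phi(x)$.
   Context: Banach spaces are over $\mathbb{C}$. A semi-inner product on a Banach space $V$ is a function $[\cdot,\cdot]_V:V\times V\to\mathbb{C}$ that is linear in its first variable, conjugate homogeneous in its second ($[f,\alpha g]_V=\overline{\alpha}[f,g]_V$), positive ($[f,f]_V>0$ for $f\neq0$), and satisfies $|[f,g]_V|\le[f,f]_V^{1/2}[g,g]_V^{1/2}$. It is compatible if $[f,f]_V^{1/2}=\|f\|_V$ for all $f\in V$. $V$ is uniformly convex if for all $\varepsilon>0$ there is $\delta>0$ with $\|f+g\|_V\le2-\delta$ whenever $\|f\|_V=\|g\|_V=1$ and $\|f-g\|_V\ge\varepsilon$. $V$ is uniformly Fréchet differentiable if $\lim_{t\in\mathbb{R},t\to0}(\|f+tg\|_V-\|f\|_V)/t$ exists uniformly over $f,g$ in the unit sphere of $V$. $V$ is called uniform if it is both uniformly convex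 and uniformly Fréchet differentiable. A uniform Banach space $V$ has a unique compatible semi-inner product, always denoted $[\cdot,\cdot]_V$; for $f\in V$, $f^*\in V^*$ is the functional $f^*(g)=[g,f]_V$, and the duality mapping $\mathcal{J}_V:V\to V^*$, $\mathcal{J}_V(f)=f^*$, is bijective and isometric (Giles). For Banach spaces $V_1,V_2$, $\mathcal{M}(V_1,V_2)$ is the set of all (not necessarily linear) maps $T:V_1\to V_2$ for which there is $\alpha\ge0$ with $\|Tu\|_{V_2}\le\alpha\|u\|_{V_1}$ for all $u\in V_1$. $\mathcal{M}(V):=\mathcal{M}(V,V)$, and $\mathcal{L}(V_1,V_2)$ is the subset of linear maps. For uniform $V_1,V_2$ and $T\in\mathcal{L}(V_1,V_2)$, the generalized adjoint $T^\dag\in\mathcal{M}(V_2,V_1)$ is defined by $[Tu,v]_{V_2}=[u,T^\dag v]_{V_1}$ for all $u\in V_1$, $v\in V_2$; equivalently $T^\dag=\mathcal{J}_{V_1}^{-1}T^*\mathcal{J}_{V_2}$. A Banach space of $\Lambda$-valued functions on $X$ is a Banach space $\mathcal{B}$ consisting of functions $X\to\Lambda$ such that $\|f\|_{\mathcal{B}}=0$ iff $f(x)=0$ for all $x\in X$. A $\Lambda$-valued RKBS on $X$ is a Banach space $\mathcal{B}$ of functions from $X$ to $\Lambda$, with both $\mathcal{B}$ and $\Lambda$ uniform, such that for every $x\in X$ the point evaluation $f\mapsto f(x)$ is continuous from $\mathcal{B}$ to $\Lambda$. The reproducing kernel of $\mathcal{B}$ is the unique function $K:X\times X\to\mathcal{M}(\Lambda)$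 such that $K(x,\cdot)\xi\in\mathcal{B}$ and $[f(x),\xi]_\Lambda=[f,K(x,\cdot)\xi]_{\mathcal{B}}$ for all $f\in\mathcal{B}$, $x\in X$, $\xi\in\Lambda$, where $K(x,\cdot)\xi$ denotes the function $y\mapsto K(x,y)\xi$. *)

theory Defs
  imports "HOL-Analysis.Analysis" "HOL-Library.Function_Algebras"
begin

text \<open>
  Banach spaces have to be quantified existentially, so they are values rather than types:
  a space is a subset of an ambient complex vector space, with a norm that matters on that subset
  only. Addition is that of the ambient type (pointwise on function types, by
  \<open>Function_Algebras\<close>); complex scalar multiplication is a component of the record.
\<close>

record 'v cspace =
  carr :: "'v set"
  scl :: "complex \<Rightarrow> 'v \<Rightarrow> 'v"
  nrm :: "'v \<Rightarrow> real"

definition complex_normed_space :: "('v::ab_group_add) cspace \<Rightarrow> bool" where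
  "complex_normed_space V \<longleftrightarrow>
     vector_space (scl V) \<and> module.subspace (scl V) (carr V) \<and>
     (\<forall>f\<in>carr V. 0 \<le> nrm V f) \<and>
     (\<forall>f\<in>carr V. nrm V f = 0 \<longleftrightarrow> f = 0) \<and>
     (\<forall>a. \<forall>f\<in>carr V. nrm V (scl V a f) = cmod a * nrm V f) \<and>
     (\<forall>f\<in>carr V. \<forall>g\<in>carr V. nrm V (f + g) \<le> nrm V f + nrm V g)"

text \<open>\<open>Metric_space\<close> demands a nonnegative symmetric distance on the whole type,
  hence the value \<open>0\<close> off the carrier.\<close>

definition cdist :: "('v::ab_group_add) cspace \<Rightarrow> 'v \<Rightarrow> 'v \<Rightarrow> real" where
  "cdist V f g = (if f \<in> carr V \<and> g \<in> carr V then nrm V (f - g) else 0)"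

abbreviation ctopology :: "('v::ab_group_add) cspace \<Rightarrow> 'v topology" where
  "ctopology V \<equiv> Metric_space.mtopology (carr V) (cdist V)"

lemma complex_normed_space_imp_Metric_space:
  assumes "complex_normed_space V"
  shows "Metric_space (carr V) (cdist V)"
proof -
  interpret vector_space "scl V"
    using assms by (simp add: complex_normed_space_def)
  have sub: "subspace (carr V)"
    and nn: "\<And>f. f \<in> carr V \<Longrightarrow> 0 \<le> nrm V f"
    and z: "\<And>f. f \<in> carr V \<Longrightarrow> nrm V f = 0 \<longleftrightarrow> f = 0"
    and h: "\<And>a f. f \<in> carr V \<Longrightarrow> nrm V (scl V a f) = cmod a * nrm V f"
    and tr: "\<And>f g. f \<in> carr V \<Longrightarrow> g \<in> carr V \<Longrightarrow> nrm V (f + g) \<le> nrm V f + nrm V g"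
    using assms by (auto simp: complex_normed_space_def)
  have d: "f - g \<in> carr V" if "f \<in> carr V" "g \<in> carr V" for f g
    using subspace_diff[OF sub] that by blast
  show ?thesis
  proof
    show "0 \<le> cdist V f g" for f g
      using nn d by (simp add: cdist_def)
    show "cdist V f g = cdist V g f" for f g
      using h[of "g - f" "-1"] d[of g f] by (auto simp: cdist_def)
    show "cdist V f g = 0 \<longleftrightarrow> f = g" if "f \<in> carr V" "g \<in> carr V" for f g
      using z[of "f - g"] d that by (simp add: cdist_def)
    show "cdist V f k \<le> cdist V f g + cdist V g k"
      if "f \<in> carr V" "g \<in> carr V" "k \<in> carr V" for f g k
      using tr[of "f - g" "g - k"] d that by (simp add: cdist_def)
  qed
qed

definition complex_banach_space :: "('v::ab_group_add) cspace \<Rightarrow> bool" where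
  "complex_banach_space V \<longleftrightarrow>
     complex_normed_space V \<and> Metric_space.mcomplete (carr V) (cdist V)"

definition closed_span :: "('v::ab_group_add) cspace \<Rightarrow> 'v set \<Rightarrow> 'v set" where
  "closed_span V S = ctopology V closure_of (module.span (scl V) S)"

definition uniformly_convex :: "('v::ab_group_add) cspace \<Rightarrow> bool" where
  "uniformly_convex V \<longleftrightarrow>
     (\<forall>\<epsilon>>0. \<exists>\<delta>>0. \<forall>f\<in>carr V. \<forall>g\<in>carr V.
        nrm V f = 1 \<and> nrm V g = 1 \<and> nrm V (f - g) \<ge> \<epsilon> \<longrightarrow> nrm V (f + g) \<le> 2 - \<delta>)"

definition unit_sphere :: "'v cspace \<Rightarrow> 'v set" where
  "unit_sphere V = {f \<in> carr V. nrm V f = 1}"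

definition uniformly_frechet_differentiable :: "('v::ab_group_add) cspace \<Rightarrow> bool" where
  "uniformly_frechet_differentiable V \<longleftrightarrow>
     (\<exists>D. uniform_limit (unit_sphere V \<times> unit_sphere V)
        (\<lambda>t::real. \<lambda>(f, g). (nrm V (f + scl V (complex_of_real t) g) - nrm V f) / t) D (at 0))"

definition uniform_banach_space :: "('v::ab_group_add) cspace \<Rightarrow> bool" where
  "uniform_banach_space V \<longleftrightarrow>
     complex_banach_space V \<and> uniformly_convex V \<and> uniformly_frechet_differentiable V"

definition semi_inner_product ::
    "('v::ab_group_add) cspace \<Rightarrow> ('v \<Rightarrow> 'v \<Rightarrow> complex) \<Rightarrow> bool" where
  "semi_inner_product V s \<longleftrightarrow>
     (\<forall>f\<in>carr V. \<forall>g\<in>carr V. \<forall>h\<in>carr V. s (f + g) h = s f h + s g h) \<and>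
     (\<forall>a. \<forall>f\<in>carr V. \<forall>g\<in>carr V. s (scl V a f) g = a * s f g) \<and>
     (\<forall>a. \<forall>f\<in>carr V. \<forall>g\<in>carr V. s f (scl V a g) = cnj a * s f g) \<and>
     (\<forall>f\<in>carr V. f \<noteq> 0 \<longrightarrow> s f f \<in> \<real> \<and> 0 < Re (s f f)) \<and>
     (\<forall>f\<in>carr V. \<forall>g\<in>carr V. cmod (s f g) \<le> sqrt (Re (s f f)) * sqrt (Re (s g g)))"

definition compatible_sip ::
    "('v::ab_group_add) cspace \<Rightarrow> ('v \<Rightarrow> 'v \<Rightarrow> complex) \<Rightarrow> bool" where
  "compatible_sip V s \<longleftrightarrow>
     semi_inner_product V s \<and> (\<forall>f\<in>carr V. sqrt (Re (s f f)) = nrm V f)"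

text \<open>On a uniform Banach space the compatible semi-inner product exists and is unique on the
  carrier (Giles); the choice operator only affects the irrelevant values off the carrier.\<close>

definition sip :: "('v::ab_group_add) cspace \<Rightarrow> 'v \<Rightarrow> 'v \<Rightarrow> complex" where
  "sip V = (SOME s. compatible_sip V s)"

text \<open>Values of maps off the carrier of their domain are irrelevant, so two elements of
  \<open>bdd_maps V1 V2\<close> are to be compared on \<open>carr V1\<close> only.\<close>

definition bdd_maps :: "'v cspace \<Rightarrow> 'w cspace \<Rightarrow> ('v \<Rightarrow> 'w) set" where
  "bdd_maps V1 V2 =
     {T \<in> carr V1 \<rightarrow> carr V2. \<exists>\<alpha>\<ge>0. \<forall>u\<in>carr V1. nrm V2 (T u) \<le> \<alpha> * nrm V1 u}"

definition bdd_lin_maps ::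
    "('v::ab_group_add) cspace \<Rightarrow> ('w::ab_group_add) cspace \<Rightarrow> ('v \<Rightarrow> 'w) set" where
  "bdd_lin_maps V1 V2 =
     {T \<in> bdd_maps V1 V2.
        (\<forall>u\<in>carr V1. \<forall>v\<in>carr V1. T (u + v) = T u + T v) \<and>
        (\<forall>a. \<forall>u\<in>carr V1. T (scl V1 a u) = scl V2 a (T u))}"

definition gen_adjoint ::
    "('v::ab_group_add) cspace \<Rightarrow> ('w::ab_group_add) cspace \<Rightarrow> ('v \<Rightarrow> 'w) \<Rightarrow> 'w \<Rightarrow> 'v" where
  "gen_adjoint V1 V2 T v =
     (THE w. w \<in> carr V1 \<and> (\<forall>u\<in>carr V1. sip V2 (T u) v = sip V1 u w))"

definition complex_line :: "complex cspace" where
  "complex_line = \<lparr>carr = UNIV, scl = (*), nrm = cmod\<rparr>"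

text \<open>Functionals are extended by \<open>0\<close> off the carrier, so that each is represented by exactly one
  function and the representatives form a subspace.\<close>

definition dual_space :: "('v::ab_group_add) cspace \<Rightarrow> ('v \<Rightarrow> complex) cspace" where
  "dual_space V =
     \<lparr>carr = {\<phi> \<in> bdd_lin_maps V complex_line. \<forall>u. u \<notin> carr V \<longrightarrow> \<phi> u = 0},
      scl = (\<lambda>a \<phi> u. a * \<phi> u),
      nrm = (\<lambda>\<phi>. SUP u\<in>{u \<in> carr V. nrm V u \<le> 1}. cmod (\<phi> u))\<rparr>"

definition duality_map :: "('v::ab_group_add) cspace \<Rightarrow> 'v \<Rightarrow> 'v \<Rightarrow> complex" where
  "duality_map V f = (\<lambda>g. if g \<in> carr V then sip V g f else 0)"

text \<open>Functions from the set \<open>X\<close> to the space \<open>L\<close> are likewise extended by \<open>0\<close> off \<open>X\<close>, and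
  the vector space operations are the pointwise ones.\<close>

definition banach_space_of_functions ::
    "'x set \<Rightarrow> ('l::ab_group_add) cspace \<Rightarrow> ('x \<Rightarrow> 'l) cspace \<Rightarrow> bool" where
  "banach_space_of_functions X L B \<longleftrightarrow>
     complex_banach_space B \<and>
     (\<forall>f\<in>carr B. (\<forall>x\<in>X. f x \<in> carr L) \<and> (\<forall>x. x \<notin> X \<longrightarrow> f x = 0)) \<and>
     scl B = (\<lambda>a f x. scl L a (f x)) \<and>
     (\<forall>f\<in>carr B. nrm B f = 0 \<longleftrightarrow> (\<forall>x\<in>X. f x = 0))"

definition rkbs ::
    "'x set \<Rightarrow> ('l::ab_group_add) cspace \<Rightarrow> ('x \<Rightarrow> 'l) cspace \<Rightarrow> bool" where
  "rkbs X L B \<longleftrightarrow>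
     banach_space_of_functions X L B \<and> uniform_banach_space B \<and> uniform_banach_space L \<and>
     (\<forall>x\<in>X. continuous_map (ctopology B) (ctopology L) (\<lambda>f. f x))"

definition kernel_section ::
    "'x set \<Rightarrow> ('x \<Rightarrow> 'x \<Rightarrow> 'l \<Rightarrow> 'l::zero) \<Rightarrow> 'x \<Rightarrow> 'l \<Rightarrow> 'x \<Rightarrow> 'l" where
  "kernel_section X K x \<xi> = (\<lambda>y. if y \<in> X then K x y \<xi> else 0)"

definition is_reproducing_kernel ::
    "'x set \<Rightarrow> ('l::ab_group_add) cspace \<Rightarrow> ('x \<Rightarrow> 'l) cspace \<Rightarrow> ('x \<Rightarrow> 'x \<Rightarrow> 'l \<Rightarrow> 'l) \<Rightarrow> bool" where
  "is_reproducing_kernel X L B K \<longleftrightarrow>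
     (\<forall>x\<in>X. \<forall>y\<in>X. K x y \<in> bdd_maps L L) \<and>
     (\<forall>x\<in>X. \<forall>\<xi>\<in>carr L. kernel_section X K x \<xi> \<in> carr B) \<and>
     (\<forall>f\<in>carr B. \<forall>x\<in>X. \<forall>\<xi>\<in>carr L. sip L (f x) \<xi> = sip B f (kernel_section X K x \<xi>))"

definition feature_representation ::
    "'x set \<Rightarrow> ('l::ab_group_add) cspace \<Rightarrow> ('x \<Rightarrow> 'x \<Rightarrow> 'l \<Rightarrow> 'l) \<Rightarrow>
     ('w::ab_group_add) cspace \<Rightarrow> ('x \<Rightarrow> 'w \<Rightarrow> 'l) \<Rightarrow> bool" where
  "feature_representation X L K W \<Phi> \<longleftrightarrow>
     uniform_banach_space W \<and>
     (\<forall>x\<in>X. \<Phi> x \<in> bdd_lin_maps W L) \<and>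
     (\<forall>x\<in>X. \<forall>y\<in>X. \<forall>\<xi>\<in>carr L. K x y \<xi> = \<Phi> y (gen_adjoint W L (\<Phi> x) \<xi>)) \<and>
     closed_span (dual_space W)
       {duality_map W (gen_adjoint W L (\<Phi> x) \<xi>) | x \<xi>. x \<in> X \<and> \<xi> \<in> carr L}
       = carr (dual_space W)"

end

theory Submission
  imports Defs
begin

text \<open>
  An RKBS is its own feature space, with the point evaluations as feature map: the adjoint of the
  evaluation at \<open>x\<close> sends \<open>\<xi>\<close> to \<open>K(x, \<cdot>)\<xi>\<close>, and a function annihilated by all
  \<open>(K(x, \<cdot>)\<xi>)\<^sup>*\<close> vanishes pointwise. Conversely, density makes \<open>u \<mapsto> (x \<mapsto> \<Phi>(x)u)\<close>
  injective on \<open>W\<close>, and its image with the norm of \<open>W\<close> is the RKBS sought.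

  That separation of points gives density is usually derived from the Hahn-Banach theorem and
  reflexivity. Here both are bypassed: if \<open>S\<close> is a subspace of the dual at distance \<open>d > 0\<close>
  from \<open>\<phi>\<close>, then by uniform convexity of \<open>V\<close> the unit vectors that nearly norm some
  \<open>\<phi> - s\<close> of norm close to \<open>d\<close> form a Cauchy family, and perturbing \<open>\<phi> - s\<close> by small
  multiples of elements of \<open>S\<close> shows that all of \<open>S\<close> vanishes at the limit.
\<close>

section \<open>Normed spaces as values\<close>

locale cnorm_space =
  fixes V :: "('v::ab_group_add) cspace"
  assumes complex_normed: "complex_normed_space V"
begin

sublocale vs: vector_space "scl V"
  using complex_normed by (simp add: complex_normed_space_def)

sublocale ms: Metric_space "carr V" "cdist V"
  using complex_normed by (rule complex_normed_space_imp_Metric_space)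

lemma subspace_carr: "vs.subspace (carr V)"
  using complex_normed by (simp add: complex_normed_space_def)

lemma carr_zero [simp, intro]: "0 \<in> carr V"
  using subspace_carr by (rule vs.subspace_0)

lemma carr_add [simp, intro]: "f \<in> carr V \<Longrightarrow> g \<in> carr V \<Longrightarrow> f + g \<in> carr V"
  using subspace_carr by (rule vs.subspace_add)

lemma carr_scl [simp, intro]: "f \<in> carr V \<Longrightarrow> scl V a f \<in> carr V"
  using subspace_carr by (rule vs.subspace_scale)

lemma carr_diff [simp, intro]: "f \<in> carr V \<Longrightarrow> g \<in> carr V \<Longrightarrow> f - g \<in> carr V"
  using subspace_carr by (rule vs.subspace_diff)

lemma carr_minus [simp, intro]: "f \<in> carr V \<Longrightarrow> - f \<in> carr V"
  using subspace_carr by (rule vs.subspace_neg)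

lemma nrm_nonneg [simp]: "f \<in> carr V \<Longrightarrow> 0 \<le> nrm V f"
  using complex_normed by (simp add: complex_normed_space_def)

lemma nrm_eq_0_iff [simp]: "f \<in> carr V \<Longrightarrow> nrm V f = 0 \<longleftrightarrow> f = 0"
  using complex_normed by (simp add: complex_normed_space_def)

lemma nrm_zero [simp]: "nrm V 0 = 0"
  by simp

lemma nrm_pos: "f \<in> carr V \<Longrightarrow> f \<noteq> 0 \<Longrightarrow> 0 < nrm V f"
  using nrm_nonneg[of f] nrm_eq_0_iff[of f] by linarith

lemma nrm_scl [simp]: "f \<in> carr V \<Longrightarrow> nrm V (scl V a f) = cmod a * nrm V f"
  using complex_normed by (simp add: complex_normed_space_def)

lemma nrm_triangle: "f \<in> carr V \<Longrightarrow> g \<in> carr V \<Longrightarrow> nrm V (f + g) \<le> nrm V f + nrm V g"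
  using complex_normed by (simp add: complex_normed_space_def)

lemma nrm_minus [simp]: "f \<in> carr V \<Longrightarrow> nrm V (- f) = nrm V f"
  using nrm_scl[of f "-1"] by simp

lemma nrm_diff_commute: "f \<in> carr V \<Longrightarrow> g \<in> carr V \<Longrightarrow> nrm V (f - g) = nrm V (g - f)"
  using nrm_minus[of "g - f"] by simp

lemma nrm_triangle_diff:
  assumes "f \<in> carr V" "g \<in> carr V" "h \<in> carr V"
  shows "nrm V (f - h) \<le> nrm V (f - g) + nrm V (g - h)"
  using nrm_triangle[of "f - g" "g - h"] assms by simp

lemma nrm_triangle_rev:
  assumes "f \<in> carr V" "g \<in> carr V"
  shows "\<bar>nrm V f - nrm V g\<bar> \<le> nrm V (f - g)"
  using nrm_triangle[of "f - g" g] nrm_triangle[of "g - f" f] nrm_diff_commute[of f g] assms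
  by auto

lemma normalize:
  assumes "f \<in> carr V" "f \<noteq> 0"
  obtains g where "g \<in> carr V" "nrm V g = 1" "f = scl V (of_real (nrm V f)) g"
proof
  let ?g = "scl V (inverse (of_real (nrm V f))) f"
  show "?g \<in> carr V" "nrm V ?g = 1" "f = scl V (of_real (nrm V f)) ?g"
    using assms nrm_pos[OF assms] by (auto simp: norm_inverse)
qed

end

locale unif_space = cnorm_space +
  assumes uniform: "uniform_banach_space V"

lemma unif_space_iff: "unif_space V \<longleftrightarrow> uniform_banach_space V"
  by (auto simp: unif_space_def unif_space_axioms_def cnorm_space_def
      uniform_banach_space_def complex_banach_space_def)

section \<open>The compatible semi-inner product\<close>

context unif_space
begin

lemma uniform_limit_nrm_quotient:
  "\<exists>D. uniform_limit (unit_sphere V \<times> unit_sphere V)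
     (\<lambda>t::real. \<lambda>(f, g). (nrm V (f + scl V (of_real t) g) - nrm V f) / t) D (at 0)"
  using uniform by (simp add: uniform_banach_space_def uniformly_frechet_differentiable_def)

text \<open>This is the Gateaux derivative of the norm. \<open>Lim\<close> makes it total, but only
  for nonzero \<open>f\<close> does \<open>tendsto_gder\<close> guarantee a limit: at
  \<open>f = 0\<close> the one-sided limits have opposite signs when \<open>g\<close> is
  nonzero.\<close>

definition gder :: "'a \<Rightarrow> 'a \<Rightarrow> real" where
  "gder f g = Lim (at 0) (\<lambda>t::real. (nrm V (f + scl V (of_real t) g) - nrm V f) / t)"

text \<open>The hypothesis speaks of the unit sphere only. With \<open>f = a f'\<close> and
  \<open>g = b g'\<close> for unit vectors, homogeneity turns the quotient of \<open>(f, g)\<close>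
  at \<open>t\<close> into \<open>b\<close> times the quotient of \<open>(f', g')\<close> at
  \<open>t * (b / a)\<close>. The case \<open>g = 0\<close> is separate because it cannot be
  normalized.\<close>

lemma tendsto_gder:
  assumes f: "f \<in> carr V" "f \<noteq> 0" and g: "g \<in> carr V"
  shows "((\<lambda>t::real. (nrm V (f + scl V (of_real t) g) - nrm V f) / t) \<longlongrightarrow> gder f g) (at 0)"
proof -
  let ?q = "\<lambda>f g. \<lambda>t::real. (nrm V (f + scl V (of_real t) g) - nrm V f) / t"
  have "\<exists>l. (?q f g \<longlongrightarrow> l) (at 0)"
  proof (cases "g = 0")
    case True
    then show ?thesis by (auto intro!: exI[of _ 0])
  next
    case False
    obtain f' where f': "f' \<in> carr V" "nrm V f' = 1" "f = scl V (of_real (nrm V f)) f'"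
      using normalize f by blast
    obtain g' where g': "g' \<in> carr V" "nrm V g' = 1" "g = scl V (of_real (nrm V g)) g'"
      using normalize g False by blast
    define a b where "a = nrm V f" and "b = nrm V g"
    have ab: "a > 0" "b > 0" using nrm_pos f g False by (auto simp: a_def b_def)
    obtain D where "uniform_limit (unit_sphere V \<times> unit_sphere V)
       (\<lambda>t::real. \<lambda>(f, g). (nrm V (f + scl V (of_real t) g) - nrm V f) / t) D (at 0)"
      using uniform_limit_nrm_quotient by blast
    from tendsto_uniform_limitI[OF this, of "(f', g')"] f' g'
    have lim: "(?q f' g' \<longlongrightarrow> D (f', g')) (at 0)"
      by (simp add: unit_sphere_def)
    have "filterlim (\<lambda>t::real. t * (b / a)) (at 0) (at 0)"
      using ab by (auto simp: filterlim_at eventually_at_filter intro!: tendsto_eq_intros)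
    from filterlim_compose[OF lim this]
    have "((\<lambda>t. b * ?q f' g' (t * (b / a))) \<longlongrightarrow> b * D (f', g')) (at 0)"
      by (intro tendsto_intros)
    also have "(\<lambda>t. b * ?q f' g' (t * (b / a))) = ?q f g"
    proof
      fix t :: real
      have "f + scl V (of_real t) g
          = scl V (of_real a) (f' + scl V (of_real (t * (b / a))) g')"
        using ab by (subst f'(3), subst g'(3)) (simp add: vs.scale_right_distrib a_def b_def)
      then have "nrm V (f + scl V (of_real t) g)
          = a * nrm V (f' + scl V (of_real (t * (b / a))) g')"
        using ab f' g' by simp
      then show "b * ?q f' g' (t * (b / a)) = ?q f g t"
        using ab f'(2) by (cases "t = 0") (auto simp: a_def[symmetric] field_simps)
    qed
    finally show ?thesis by blast
  qed
  then obtain l where l: "(?q f g \<longlongrightarrow> l) (at 0)" ..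
  then have "gder f g = l"
    unfolding gder_def by (rule tendsto_Lim[OF trivial_limit_at])
  with l show ?thesis by simp
qed

text \<open>Dividing by positive and by negative \<open>t\<close> bounds the derivative from both
  sides, so a linear minorant of the increment of the norm has its slope forced. This is the device
  by which norm inequalities become identities for semi-inner products and functionals.\<close>

lemma gder_unique:
  assumes f: "f \<in> carr V" "f \<noteq> 0" and g: "g \<in> carr V"
    and le: "\<And>t::real. t * a \<le> c * (nrm V (f + scl V (of_real t) g) - nrm V f)"
  shows "a = c * gder f g"
proof (rule antisym)
  have lim: "((\<lambda>t::real. c * ((nrm V (f + scl V (of_real t) g) - nrm V f) / t)) \<longlongrightarrow> c * gder f g) (at 0)"
    by (intro tendsto_intros tendsto_gder f g)
  have ev: "a \<le> c * (nrm V (f + scl V (of_real t) g) - nrm V f) / t" if "t > 0" for t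
    using le[of t] that by (simp add: field_simps)
  have ev': "c * (nrm V (f + scl V (of_real t) g) - nrm V f) / t \<le> a" if "t < 0" for t
    using le[of t] that by (simp add: field_simps)
  show "a \<le> c * gder f g"
    by (rule tendsto_lowerbound[OF tendsto_mono[OF at_le[OF subset_UNIV] lim, of "{0<..}"]])
      (auto simp: eventually_at_topological intro!: exI[of _ UNIV] ev)
  show "c * gder f g \<le> a"
    by (rule tendsto_upperbound[OF tendsto_mono[OF at_le[OF subset_UNIV] lim, of "{..<0}"]])
      (auto simp: eventually_at_topological intro!: exI[of _ UNIV] ev')
qed

lemma gder_scale:
  assumes f: "f \<in> carr V" "f \<noteq> 0" and g: "g \<in> carr V"
  shows "gder f (scl V (of_real r) g) = r * gder f g"
proof (cases "r = 0")
  case True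
  have "0 = 1 * gder f 0" by (rule gder_unique) (use f in auto)
  with True show ?thesis by simp
next
  case False
  have "filterlim (\<lambda>t::real. t * r) (at 0) (at 0)"
    using False by (auto simp: filterlim_at eventually_at_filter intro!: tendsto_eq_intros)
  from filterlim_compose[OF tendsto_gder[OF f g] this]
  have "((\<lambda>t. r * ((nrm V (f + scl V (of_real (t * r)) g) - nrm V f) / (t * r))) \<longlongrightarrow> r * gder f g) (at 0)"
    by (intro tendsto_intros)
  also have "(\<lambda>t. r * ((nrm V (f + scl V (of_real (t * r)) g) - nrm V f) / (t * r)))
      = (\<lambda>t. (nrm V (f + scl V (of_real t) (scl V (of_real r) g)) - nrm V f) / t)"
    using False by auto
  finally show ?thesis
    by (rule tendsto_unique[OF trivial_limit_at tendsto_gder[OF f carr_scl[OF g]]])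
qed

text \<open>Since \<open>2 (f + t (g + h)) = (f + 2 t g) + (f + 2 t h)\<close>, the triangle
  inequality bounds the quotient at \<open>t\<close> by the sum of the quotients at
  \<open>2 t\<close>. The limit is taken from the right to keep the sign of
  \<open>t\<close>.\<close>

lemma gder_add_le:
  assumes f: "f \<in> carr V" "f \<noteq> 0" and g: "g \<in> carr V" and h: "h \<in> carr V"
  shows "gder f (g + h) \<le> gder f g + gder f h"
proof -
  let ?q = "\<lambda>g. \<lambda>t::real. (nrm V (f + scl V (of_real t) g) - nrm V f) / t"
  have quot: "(p - n) / t \<le> (q - n) / (2 * t) + (r - n) / (2 * t)"
    if "2 * p \<le> q + r" "0 < t" for p q r n t :: real
  proof -
    have "(p - n) / t \<le> ((q + r) / 2 - n) / t"
      using that by (intro divide_right_mono) auto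
    also have "\<dots> = (q - n) / (2 * t) + (r - n) / (2 * t)"
      using that by (simp add: field_simps)
    finally show ?thesis .
  qed
  have right: "(?q g \<longlongrightarrow> gder f g) (at_right 0)" if "g \<in> carr V" for g
    by (rule tendsto_mono[OF at_le tendsto_gder]) (use f that in auto)
  have dbl: "filterlim (\<lambda>t::real. 2 * t) (at_right 0) (at_right 0)"
    by (auto simp: filterlim_at eventually_at_filter intro!: tendsto_eq_intros)
  have "((\<lambda>t. ?q g (2 * t) + ?q h (2 * t)) \<longlongrightarrow> gder f g + gder f h) (at_right 0)"
    by (intro tendsto_add filterlim_compose[OF right dbl] g h)
  moreover have "?q (g + h) t \<le> ?q g (2 * t) + ?q h (2 * t)" if "t > 0" for t
  proof -
    have "scl V 2 (f + scl V (of_real t) (g + h))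
        = (f + scl V (of_real (2 * t)) g) + (f + scl V (of_real (2 * t)) h)"
      using vs.scale_left_distrib[of 1 1 f]
      by (simp add: vs.scale_right_distrib algebra_simps)
    then have "2 * nrm V (f + scl V (of_real t) (g + h))
        = nrm V ((f + scl V (of_real (2 * t)) g) + (f + scl V (of_real (2 * t)) h))"
      using nrm_scl[of "f + scl V (of_real t) (g + h)" 2] f g h by simp
    also have "\<dots> \<le> nrm V (f + scl V (of_real (2 * t)) g) + nrm V (f + scl V (of_real (2 * t)) h)"
      by (rule nrm_triangle) (use f g h in auto)
    finally show ?thesis by (rule quot[OF _ that])
  qed
  ultimately show ?thesis
    using right[OF carr_add[OF g h]]
    by (intro tendsto_le[of "at_right (0::real)"]) (auto simp: eventually_at_filter)
qed

lemma gder_minus: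
  assumes f: "f \<in> carr V" "f \<noteq> 0" and g: "g \<in> carr V"
  shows "gder f (- g) = - gder f g"
  using gder_scale[OF f g, of "-1"] by simp

text \<open>Subadditivity at \<open>- g\<close> and \<open>- h\<close>, combined with oddness, gives
  the reverse inequality. Oddness is what the two-sided limit contributes.\<close>

lemma gder_add:
  assumes f: "f \<in> carr V" "f \<noteq> 0" and g: "g \<in> carr V" and h: "h \<in> carr V"
  shows "gder f (g + h) = gder f g + gder f h"
  using gder_add_le[OF f g h] gder_add_le[OF f, of "-g" "-h"] gder_minus[OF f, of "g + h"] g h
  by (simp add: gder_minus f)

lemma gder_le:
  assumes f: "f \<in> carr V" "f \<noteq> 0" and g: "g \<in> carr V"
  shows "gder f g \<le> nrm V g"
proof -
  have "((\<lambda>t::real. (nrm V (f + scl V (of_real t) g) - nrm V f) / t) \<longlongrightarrow> gder f g) (at_right 0)"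
    by (rule tendsto_mono[OF at_le tendsto_gder]) (use f g in auto)
  moreover have "(nrm V (f + scl V (of_real t) g) - nrm V f) / t \<le> nrm V g" if "t > 0" for t
    using nrm_triangle[of f "scl V (of_real t) g"] that f g by (simp add: field_simps)
  ultimately show ?thesis
    by (intro tendsto_upperbound[of _ _ "at_right (0::real)"]) (auto simp: eventually_at_filter)
qed

text \<open>The scalar is pulled out of the norm:
  \<open>a f + t g = a (f + t (inverse a) g)\<close>. This yields the conjugate homogeneity of the
  semi-inner product in its second variable.\<close>

lemma gder_scale_left:
  assumes f: "f \<in> carr V" "f \<noteq> 0" and g: "g \<in> carr V" and a: "a \<noteq> 0"
  shows "gder (scl V a f) g = cmod a * gder f (scl V (inverse a) g)"
proof -
  have "nrm V (scl V a f + scl V (of_real t) g) - nrm V (scl V a f)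
      = cmod a * (nrm V (f + scl V (of_real t) (scl V (inverse a) g)) - nrm V f)" for t
  proof -
    have "scl V a f + scl V (of_real t) g
        = scl V a (f + scl V (of_real t) (scl V (inverse a) g))"
    proof -
      have "a * (of_real t * inverse a) = of_real t" using a by simp
      then show ?thesis by (simp only: vs.scale_right_distrib vs.scale_scale)
    qed
    with f g show ?thesis by (simp only: nrm_scl carr_add carr_scl right_diff_distrib)
  qed
  then have "((\<lambda>t::real. (nrm V (scl V a f + scl V (of_real t) g) - nrm V (scl V a f)) / t)
      \<longlongrightarrow> cmod a * gder f (scl V (inverse a) g)) (at 0)"
    using tendsto_mult_left[OF tendsto_gder[OF f carr_scl[OF g, of "inverse a"]], of "cmod a"]
    by (simp only: times_divide_eq_right)
  then show ?thesis
    unfolding gder_def[of "scl V a f"] by (rule tendsto_Lim[OF trivial_limit_at])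
qed

text \<open>In direction \<open>- f\<close> the quotient is constantly \<open>- nrm V f\<close> for
  \<open>0 < t < 1\<close>, because \<open>f - t f = (1 - t) f\<close>. Oddness then gives the lower
  bound.\<close>

lemma gder_self:
  assumes f: "f \<in> carr V" "f \<noteq> 0"
  shows "gder f f = nrm V f"
proof (rule antisym)
  show "gder f f \<le> nrm V f" using gder_le[OF f f(1)] .
  have "gder f (- f) \<le> - nrm V f"
  proof -
    have "((\<lambda>t::real. (nrm V (f + scl V (of_real t) (-f)) - nrm V f) / t) \<longlongrightarrow> gder f (-f)) (at_right 0)"
      by (rule tendsto_mono[OF at_le tendsto_gder]) (use f in auto)
    moreover have "(nrm V (f + scl V (of_real t) (-f)) - nrm V f) / t = - nrm V f" if "0 < t" "t < 1" for t
    proof -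
      have "f + scl V (of_real t) (-f) = scl V (of_real (1 - t)) f"
        using vs.scale_left_diff_distrib[of 1 "of_real t" f] by simp
      moreover have "nrm V (scl V (of_real (1 - t)) f) = (1 - t) * nrm V f"
        using nrm_scl[OF f(1), of "of_real (1 - t)"] that
        by (metis abs_of_pos diff_gt_0_iff_gt norm_of_real)
      ultimately show ?thesis using that f by (simp add: field_simps)
    qed
    then have "\<forall>\<^sub>F t in at_right 0. (nrm V (f + scl V (of_real t) (-f)) - nrm V f) / t \<le> - nrm V f"
      by (intro eventually_at_rightI[of 0 1]) auto
    ultimately show ?thesis
      by (intro tendsto_upperbound[of _ _ "at_right (0::real)"]) auto
  qed
  then show "nrm V f \<le> gder f f" using gder_minus[OF f f(1)] by simp
qed

text \<open>As \<open>1 + t \<i>\<close> has modulus at least 1, the norm on the real line through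
  \<open>f\<close> in direction \<open>\<i> f\<close> is minimal at \<open>f\<close>. This makes
  \<open>[f, f]\<close> real.\<close>

lemma gder_imaginary_self:
  assumes f: "f \<in> carr V" "f \<noteq> 0"
  shows "gder f (scl V \<i> f) = 0"
proof -
  have "0 = 1 * gder f (scl V \<i> f)"
  proof (rule gder_unique[OF f])
    fix t :: real
    have "f + scl V (of_real t) (scl V \<i> f) = scl V (1 + of_real t * \<i>) f"
      by (simp add: vs.scale_left_distrib)
    moreover have "1 \<le> cmod (1 + of_real t * \<i>)"
      using complex_Re_le_cmod[of "1 + of_real t * \<i>"] by simp
    ultimately show "t * 0 \<le> 1 * (nrm V (f + scl V (of_real t) (scl V \<i> f)) - nrm V f)"
      using f mult_right_mono[of 1 "cmod (1 + of_real t * \<i>)" "nrm V f"] by (simp del: vs.scale_scale)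
  qed (use f in auto)
  then show ?thesis by simp
qed

text \<open>Giles' construction: the real part of \<open>[g, f]\<close> is \<open>\<parallel>f\<parallel>\<close> times the derivative of the
  norm at \<open>f\<close> in direction \<open>g\<close>.\<close>

lemma compatible_sip_exists: "\<exists>s. compatible_sip V s"
proof -
  \<comment> \<open>A complex-linear functional is determined by its real part, its imaginary part
    at \<open>g\<close> being minus the real part at \<open>\<i> g\<close>. The value at
    \<open>f = 0\<close> is set by hand, as the derivative means nothing there.\<close>
  define s where "s = (\<lambda>g f. if f = 0 then 0
    else of_real (nrm V f) * Complex (gder f g) (- gder f (scl V \<i> g)))"
  have add: "s (f + g) h = s f h + s g h"
    if "f \<in> carr V" "g \<in> carr V" "h \<in> carr V" for f g h
    using that by (auto simp: s_def gder_add vs.scale_right_distrib complex_eq_iff algebra_simps)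
  have real: "s (scl V (of_real r) g) f = of_real r * s g f"
    if "f \<in> carr V" "g \<in> carr V" for f g r
  proof -
    have "scl V \<i> (scl V (of_real r) g) = scl V (of_real r) (scl V \<i> g)"
      by (simp add: mult.commute)
    with that show ?thesis
      by (auto simp: s_def gder_scale complex_eq_iff simp del: vs.scale_scale)
  qed
  have imag: "s (scl V \<i> g) f = \<i> * s g f"
    if "f \<in> carr V" "g \<in> carr V" for f g
    using that by (auto simp: s_def gder_minus complex_eq_iff)
  have scale: "s (scl V a g) f = a * s g f" if fg: "f \<in> carr V" "g \<in> carr V" for f g a
  proof -
    have "scl V a g = scl V (of_real (Re a)) g + scl V (of_real (Im a)) (scl V \<i> g)"
      using complex_eq[of a]
      by (metis mult.commute vs.scale_left_distrib vs.scale_scale)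
    then have "s (scl V a g) f = of_real (Re a) * s g f + of_real (Im a) * (\<i> * s g f)"
      using fg by (simp only: add real imag carr_scl)
    also have "\<dots> = a * s g f"
      by (simp add: complex_eq_iff algebra_simps)
    finally show ?thesis .
  qed
  have conj: "s g (scl V a f) = cnj a * s g f" if fg: "f \<in> carr V" "g \<in> carr V" for f g a
  proof (cases "a = 0 \<or> f = 0")
    case True
    then show ?thesis by (auto simp: s_def)
  next
    case False
    then have *: "gder (scl V a f) h = cmod a * gder f (scl V (inverse a) h)" if "h \<in> carr V" for h
      using gder_scale_left fg that by simp
    \<comment> \<open>One factor \<open>cmod a\<close> comes from the norm of \<open>a f\<close>,
      the other from the derivative at \<open>a f\<close>; together with \<open>inverse a\<close>
      they make \<open>cnj a\<close>.\<close>
    have "s g (scl V a f) = of_real (cmod a * cmod a) * s (scl V (inverse a) g) f"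
      using fg False * by (auto simp: s_def complex_eq_iff algebra_simps)
    also have "\<dots> = (of_real (cmod a * cmod a) * inverse a) * s g f"
      using scale[OF fg] by simp
    also have "of_real (cmod a * cmod a) * inverse a = cnj a"
      using False complex_norm_square[of a] by (simp add: power2_eq_square)
    finally show ?thesis .
  qed
  have self: "s f f = of_real ((nrm V f)\<^sup>2)" if "f \<in> carr V" for f
    using that by (auto simp: s_def gder_self gder_imaginary_self complex_eq_iff power2_eq_square)
  have Re_le: "Re (s g f) \<le> nrm V g * nrm V f" if "f \<in> carr V" "g \<in> carr V" for f g
    using that gder_le[of f g] by (auto simp: s_def mult.commute mult_left_mono)
  have cs: "cmod (s g f) \<le> nrm V g * nrm V f" if fg: "f \<in> carr V" "g \<in> carr V" for f g
  proof (cases "s g f = 0")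
    case True
    then show ?thesis using fg by simp
  next
    case False
    \<comment> \<open>A unimodular factor rotates \<open>s g f\<close> onto the positive real axis,
      where the bound on real parts bounds the modulus.\<close>
    define a where "a = cnj (s g f) / of_real (cmod (s g f))"
    have "s (scl V a g) f = of_real (cmod (s g f))"
      using False scale[OF fg] complex_norm_square[of "s g f"]
      by (simp add: a_def field_simps power2_eq_square)
    moreover have "cmod a = 1" using False by (simp add: a_def norm_divide)
    ultimately show ?thesis using Re_le[of f "scl V a g"] fg by simp
  qed
  have "compatible_sip V s"
    unfolding compatible_sip_def semi_inner_product_def
    using add scale conj self cs nrm_pos by auto
  then show ?thesis by blast
qed

lemma compatible_sip_sip: "compatible_sip V (sip V)"
  unfolding sip_def by (rule someI_ex[OF compatible_sip_exists])

end

section \<open>Rules for an arbitrary compatible semi-inner product\<close>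

context cnorm_space
begin

context
  fixes s assumes comp: "compatible_sip V s"
begin

lemma csip_add_left: "f \<in> carr V \<Longrightarrow> g \<in> carr V \<Longrightarrow> h \<in> carr V \<Longrightarrow> s (f + g) h = s f h + s g h"
  using comp by (simp add: compatible_sip_def semi_inner_product_def)

lemma csip_scl_left: "f \<in> carr V \<Longrightarrow> g \<in> carr V \<Longrightarrow> s (scl V a f) g = a * s f g"
  using comp by (simp add: compatible_sip_def semi_inner_product_def)

lemma csip_scl_right: "f \<in> carr V \<Longrightarrow> g \<in> carr V \<Longrightarrow> s f (scl V a g) = cnj a * s f g"
  using comp by (simp add: compatible_sip_def semi_inner_product_def)

lemma csip_zero_left: "g \<in> carr V \<Longrightarrow> s 0 g = 0"
  using csip_scl_left[of 0 g 0] by simp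

lemma csip_zero_right: "g \<in> carr V \<Longrightarrow> s g 0 = 0"
  using csip_scl_right[of g 0 0] by simp

lemma csip_cauchy_schwarz:
  assumes "f \<in> carr V" "g \<in> carr V"
  shows "cmod (s f g) \<le> nrm V f * nrm V g"
proof -
  have "cmod (s f g) \<le> sqrt (Re (s f f)) * sqrt (Re (s g g))"
    using comp assms unfolding compatible_sip_def semi_inner_product_def by blast
  moreover have "sqrt (Re (s f f)) = nrm V f" "sqrt (Re (s g g)) = nrm V g"
    using comp assms unfolding compatible_sip_def by blast+
  ultimately show ?thesis by simp
qed

lemma csip_self:
  assumes "f \<in> carr V"
  shows "s f f = of_real ((nrm V f)\<^sup>2)"
proof (cases "f = 0")
  case True
  then show ?thesis using csip_zero_left[OF assms] by simp
next
  case False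
  then have "s f f \<in> \<real>" "0 < Re (s f f)" "sqrt (Re (s f f)) = nrm V f"
    using comp assms by (auto simp: compatible_sip_def semi_inner_product_def)
  then show ?thesis
    by (metis Re_complex_of_real Reals_cases less_eq_real_def real_sqrt_pow2)
qed

end

end

section \<open>Uniqueness of the compatible semi-inner product\<close>

context unif_space
begin

text \<open>Expanding \<open>[f + t g, f]\<close> and applying Cauchy-Schwarz gives exactly the
  linear minorant that \<open>gder_unique\<close> asks for.\<close>

lemma Re_csip_eq:
  assumes comp: "compatible_sip V s" and f: "f \<in> carr V" "f \<noteq> 0" and g: "g \<in> carr V"
  shows "Re (s g f) = nrm V f * gder f g"
proof (rule gder_unique[OF f g])
  fix t :: real
  have "(nrm V f)\<^sup>2 + t * Re (s g f) = Re (s (f + scl V (of_real t) g) f)"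
    using f g by (simp add: csip_add_left[OF comp] csip_scl_left[OF comp] csip_self[OF comp])
  also have "\<dots> \<le> nrm V (f + scl V (of_real t) g) * nrm V f"
    using csip_cauchy_schwarz[OF comp, of "f + scl V (of_real t) g" f]
      complex_Re_le_cmod[of "s (f + scl V (of_real t) g) f"] f g by simp
  finally show "t * Re (s g f) \<le> nrm V f * (nrm V (f + scl V (of_real t) g) - nrm V f)"
    by (simp add: power2_eq_square algebra_simps)
qed

text \<open>The norm determines the real parts by \<open>Re_csip_eq\<close>, and the real part at
  \<open>\<i> g\<close> determines the imaginary part at \<open>g\<close>. Because
  \<open>sip\<close> is a choice, this is how it can later be computed on a concrete space.\<close>

lemma csip_unique:
  assumes s: "compatible_sip V s" and f: "f \<in> carr V" and g: "g \<in> carr V"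
  shows "s g f = sip V g f"
proof (cases "f = 0")
  case True
  then show ?thesis using g csip_zero_right[OF s] csip_zero_right[OF compatible_sip_sip] by simp
next
  case False
  have Re: "Re (s h f) = Re (sip V h f)" if "h \<in> carr V" for h
    using Re_csip_eq[OF s f False that] Re_csip_eq[OF compatible_sip_sip f False that] by simp
  from Re[of "scl V \<i> g"] Re[of g] show ?thesis
    using f g by (simp add: csip_scl_left[OF s] csip_scl_left[OF compatible_sip_sip] complex_eq_iff)
qed

lemmas sip_add_left = csip_add_left[OF compatible_sip_sip]
lemmas sip_scl_left = csip_scl_left[OF compatible_sip_sip]
lemmas sip_scl_right = csip_scl_right[OF compatible_sip_sip]
lemmas sip_zero_right = csip_zero_right[OF compatible_sip_sip]
lemmas sip_cauchy_schwarz = csip_cauchy_schwarz[OF compatible_sip_sip]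
lemmas sip_self = csip_self[OF compatible_sip_sip]

end

section \<open>The dual space and the Riesz representation\<close>

context cnorm_space
begin

lemma carr_dual_iff:
  "\<phi> \<in> carr (dual_space V) \<longleftrightarrow>
     (\<forall>u\<in>carr V. \<forall>v\<in>carr V. \<phi> (u + v) = \<phi> u + \<phi> v) \<and>
     (\<forall>a. \<forall>u\<in>carr V. \<phi> (scl V a u) = a * \<phi> u) \<and>
     (\<exists>\<alpha>\<ge>0. \<forall>u\<in>carr V. cmod (\<phi> u) \<le> \<alpha> * nrm V u) \<and>
     (\<forall>u. u \<notin> carr V \<longrightarrow> \<phi> u = 0)"
  by (auto simp: dual_space_def bdd_lin_maps_def bdd_maps_def complex_line_def)

lemma scl_dual [simp]: "scl (dual_space V) = (\<lambda>a \<phi> u. a * \<phi> u)"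
  by (simp add: dual_space_def)

lemma dual_add: "\<phi> \<in> carr (dual_space V) \<Longrightarrow> u \<in> carr V \<Longrightarrow> v \<in> carr V \<Longrightarrow> \<phi> (u + v) = \<phi> u + \<phi> v"
  by (simp add: carr_dual_iff)

lemma dual_scl: "\<phi> \<in> carr (dual_space V) \<Longrightarrow> u \<in> carr V \<Longrightarrow> \<phi> (scl V a u) = a * \<phi> u"
  by (simp add: carr_dual_iff)

lemma dual_diff:
  assumes "\<phi> \<in> carr (dual_space V)" "u \<in> carr V" "v \<in> carr V"
  shows "\<phi> (u - v) = \<phi> u - \<phi> v"
  using dual_add[OF assms(1), of "u - v" v] assms by simp

lemma dual_bdd_above:
  assumes "\<phi> \<in> carr (dual_space V)"
  shows "bdd_above ((\<lambda>u. cmod (\<phi> u)) ` {u \<in> carr V. nrm V u \<le> 1})"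
proof -
  obtain \<alpha> where \<alpha>: "0 \<le> \<alpha>" "\<And>u. u \<in> carr V \<Longrightarrow> cmod (\<phi> u) \<le> \<alpha> * nrm V u"
    using assms by (auto simp: carr_dual_iff)
  have "cmod (\<phi> u) \<le> \<alpha>" if "u \<in> carr V" "nrm V u \<le> 1" for u
    using \<alpha>(2)[OF that(1)] mult_left_mono[OF that(2) \<alpha>(1)] by simp
  then show ?thesis by (auto intro!: bdd_aboveI)
qed

lemma dual_bound_unit:
  assumes "\<phi> \<in> carr (dual_space V)" "u \<in> carr V" "nrm V u \<le> 1"
  shows "cmod (\<phi> u) \<le> nrm (dual_space V) \<phi>"
  using cSUP_upper[OF _ dual_bdd_above[OF assms(1)]] assms by (simp add: dual_space_def)

lemma nrm_dual_nonneg: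
  assumes "\<phi> \<in> carr (dual_space V)"
  shows "0 \<le> nrm (dual_space V) \<phi>"
  using order_trans[OF norm_ge_zero dual_bound_unit[OF assms, of 0]] by simp

lemma dual_bound:
  assumes \<phi>: "\<phi> \<in> carr (dual_space V)" and u: "u \<in> carr V"
  shows "cmod (\<phi> u) \<le> nrm (dual_space V) \<phi> * nrm V u"
proof (cases "u = 0")
  case True
  then show ?thesis using dual_scl[OF \<phi>, of 0 0] by simp
next
  case False
  then obtain v where v: "v \<in> carr V" "nrm V v = 1" "u = scl V (of_real (nrm V u)) v"
    using normalize u by blast
  have "cmod (\<phi> u) = nrm V u * cmod (\<phi> v)"
    using dual_scl[OF \<phi> v(1), of "of_real (nrm V u)"] v(3) u by (simp add: norm_mult)
  then show ?thesis
    using dual_bound_unit[OF \<phi> v(1)] v(2) u by (simp add: mult.commute mult_left_mono)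
qed

lemma Re_dual_le:
  assumes "\<phi> \<in> carr (dual_space V)" "u \<in> carr V"
  shows "Re (\<phi> u) \<le> nrm (dual_space V) \<phi> * nrm V u"
  using complex_Re_le_cmod dual_bound[OF assms] by (rule order_trans)

lemma nrm_dual_le:
  assumes "\<And>u. u \<in> carr V \<Longrightarrow> nrm V u \<le> 1 \<Longrightarrow> cmod (\<phi> u) \<le> c"
  shows "nrm (dual_space V) \<phi> \<le> c"
proof -
  have "0 \<in> {u \<in> carr V. nrm V u \<le> 1}" by simp
  then have "{u \<in> carr V. nrm V u \<le> 1} \<noteq> {}" by blast
  then show ?thesis
    unfolding dual_space_def using assms by (auto intro!: cSUP_least)
qed

lemma complex_normed_space_dual: "complex_normed_space (dual_space V)"
proof -
  have vs: "vector_space (scl (dual_space V))"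
    by unfold_locales (auto simp: fun_eq_iff algebra_simps)
  then have mod: "module (scl (dual_space V))"
    by (simp only: module_iff_vector_space)
  have sub: "module.subspace (scl (dual_space V)) (carr (dual_space V))"
    unfolding module.subspace_def[OF mod]
  proof -
    have "0 \<in> carr (dual_space V)" by (auto simp: carr_dual_iff)
    moreover have "\<phi> + \<psi> \<in> carr (dual_space V)"
      if \<phi>: "\<phi> \<in> carr (dual_space V)" and \<psi>: "\<psi> \<in> carr (dual_space V)" for \<phi> \<psi>
    proof -
      have "cmod (\<phi> u + \<psi> u) \<le> (nrm (dual_space V) \<phi> + nrm (dual_space V) \<psi>) * nrm V u"
        if "u \<in> carr V" for u
        using norm_triangle_ineq[of "\<phi> u" "\<psi> u"] dual_bound[OF \<phi> that] dual_bound[OF \<psi> that]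
        by (simp add: algebra_simps)
      moreover have "0 \<le> nrm (dual_space V) \<phi> + nrm (dual_space V) \<psi>"
        using nrm_dual_nonneg \<phi> \<psi> by simp
      ultimately have "\<exists>\<alpha>\<ge>0. \<forall>u\<in>carr V. cmod (\<phi> u + \<psi> u) \<le> \<alpha> * nrm V u" by blast
      then show ?thesis
        using \<phi> \<psi> by (auto simp: carr_dual_iff distrib_left)
    qed
    moreover have "scl (dual_space V) c \<phi> \<in> carr (dual_space V)"
      if \<phi>: "\<phi> \<in> carr (dual_space V)" for c \<phi>
    proof -
      have "cmod (c * \<phi> u) \<le> (cmod c * nrm (dual_space V) \<phi>) * nrm V u" if "u \<in> carr V" for u
        using mult_left_mono[OF dual_bound[OF \<phi> that], of "cmod c"] by (simp add: norm_mult mult.assoc)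
      moreover have "0 \<le> cmod c * nrm (dual_space V) \<phi>"
        using nrm_dual_nonneg \<phi> by simp
      ultimately have "\<exists>\<alpha>\<ge>0. \<forall>u\<in>carr V. cmod (c * \<phi> u) \<le> \<alpha> * nrm V u" by blast
      then show ?thesis
        using \<phi> by (auto simp: carr_dual_iff distrib_left)
    qed
    ultimately show "0 \<in> carr (dual_space V) \<and>
        (\<forall>x\<in>carr (dual_space V). \<forall>y\<in>carr (dual_space V). x + y \<in> carr (dual_space V)) \<and>
        (\<forall>c. \<forall>x\<in>carr (dual_space V). scl (dual_space V) c x \<in> carr (dual_space V))" by blast
  qed
  have "nrm (dual_space V) \<phi> = 0 \<longleftrightarrow> \<phi> = 0" if \<phi>: "\<phi> \<in> carr (dual_space V)" for \<phi>
  proof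
    assume "nrm (dual_space V) \<phi> = 0"
    then have "\<phi> u = 0" for u
      using dual_bound[OF \<phi>, of u] \<phi> by (cases "u \<in> carr V") (auto simp: carr_dual_iff)
    then show "\<phi> = 0" by (simp add: fun_eq_iff)
  next
    assume "\<phi> = 0"
    then show "nrm (dual_space V) \<phi> = 0"
      using nrm_dual_le[of \<phi> 0] nrm_dual_nonneg[OF \<phi>] by simp
  qed
  moreover have "nrm (dual_space V) (\<phi> + \<psi>) \<le> nrm (dual_space V) \<phi> + nrm (dual_space V) \<psi>"
    if "\<phi> \<in> carr (dual_space V)" "\<psi> \<in> carr (dual_space V)" for \<phi> \<psi>
  proof (rule nrm_dual_le)
    fix u assume "u \<in> carr V" "nrm V u \<le> 1"
    with that show "cmod ((\<phi> + \<psi>) u) \<le> nrm (dual_space V) \<phi> + nrm (dual_space V) \<psi>"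
      using norm_triangle_mono[OF dual_bound_unit dual_bound_unit] by simp
  qed
  moreover have "nrm (dual_space V) (scl (dual_space V) a \<phi>) = cmod a * nrm (dual_space V) \<phi>"
    if \<phi>: "\<phi> \<in> carr (dual_space V)" for a \<phi>
  proof -
    have le: "nrm (dual_space V) (\<lambda>u. a * \<psi> u) \<le> cmod a * nrm (dual_space V) \<psi>"
      if "\<psi> \<in> carr (dual_space V)" for a \<psi>
      by (rule nrm_dual_le) (use dual_bound_unit[OF that] in \<open>auto simp: norm_mult mult_left_mono\<close>)
    show ?thesis
    proof (cases "a = 0")
      case True
      have "0 \<le> nrm (dual_space V) (\<lambda>u. 0)"
        by (rule nrm_dual_nonneg) (auto simp: carr_dual_iff)
      then show ?thesis using le[OF \<phi>, of 0] True by simp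
    next
      case False
      have mem: "(\<lambda>u. a * \<phi> u) \<in> carr (dual_space V)"
        using module.subspace_scale[OF mod sub \<phi>, of a] by simp
      \<comment> \<open>The reverse inequality is \<open>le\<close> applied to the scaled functional
        and the factor \<open>inverse a\<close>.\<close>
      have "nrm (dual_space V) \<phi> = nrm (dual_space V) (\<lambda>u. inverse a * (a * \<phi> u))"
        using False by (simp add: mult.assoc[symmetric])
      also have "\<dots> \<le> cmod (inverse a) * nrm (dual_space V) (\<lambda>u. a * \<phi> u)"
        by (rule le[OF mem])
      finally have "cmod a * nrm (dual_space V) \<phi> \<le> cmod a * (cmod (inverse a) * nrm (dual_space V) (\<lambda>u. a * \<phi> u))"
        by (intro mult_left_mono) auto
      also have "\<dots> = nrm (dual_space V) (\<lambda>u. a * \<phi> u)"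
        using False by (simp add: norm_inverse)
      finally show ?thesis using le[OF \<phi>, of a] by simp
    qed
  qed
  ultimately show ?thesis
    unfolding complex_normed_space_def using vs sub nrm_dual_nonneg by blast
qed

text \<open>The supremum supplies a vector of the unit ball. Normalizing it cannot decrease
  \<open>cmod (\<phi> u)\<close>, and a rotation makes the value real and positive. Exceeding
  \<open>max e 0\<close> rather than \<open>e\<close> ensures that \<open>u\<close> and
  \<open>\<phi> u\<close> are nonzero, so that both operations are possible.\<close>

lemma nearly_norming_vector:
  assumes \<phi>: "\<phi> \<in> carr (dual_space V)" and e: "e < nrm (dual_space V) \<phi>"
    and pos: "0 < nrm (dual_space V) \<phi>"
  obtains u where "u \<in> carr V" "nrm V u = 1" "e < Re (\<phi> u)"
proof -
  have "max e 0 < nrm (dual_space V) \<phi>" using e pos by simp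
  then obtain u where u: "u \<in> carr V" "nrm V u \<le> 1" "max e 0 < cmod (\<phi> u)"
    using nrm_dual_le[of \<phi> "max e 0"] by (meson not_le)
  have "u \<noteq> 0" using u(3) dual_scl[OF \<phi>, of 0 0] by auto
  with u have n: "0 < nrm V u" "0 < cmod (\<phi> u)" using nrm_pos by auto
  let ?a = "cnj (\<phi> u) / of_real (cmod (\<phi> u) * nrm V u)"
  have "cmod ?a * nrm V u = 1" using n by (simp add: norm_divide norm_mult)
  moreover have "?a * \<phi> u = of_real (cmod (\<phi> u) / nrm V u)"
    using n complex_norm_square[of "\<phi> u"] by (simp add: field_simps power2_eq_square)
  moreover have "cmod (\<phi> u) \<le> cmod (\<phi> u) / nrm V u"
    using n u(2) by (simp add: field_simps)
  ultimately show ?thesis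
    using that[of "scl V ?a u"] u dual_scl[OF \<phi> u(1), of ?a] by simp
qed

end

section \<open>Norm attainment and representation of functionals\<close>

context unif_space
begin

lemma Cauchy_limit:
  assumes \<sigma>: "\<And>n. \<sigma> n \<in> carr V"
    and Cauchy: "\<And>e. 0 < e \<Longrightarrow> \<exists>M. \<forall>m\<ge>M. \<forall>n\<ge>M. nrm V (\<sigma> m - \<sigma> n) < e"
  obtains u where "u \<in> carr V" "(\<lambda>n. nrm V (\<sigma> n - u)) \<longlonglongrightarrow> 0"
proof -
  have "ms.MCauchy \<sigma>"
    unfolding ms.MCauchy_def using \<sigma> Cauchy by (auto simp: cdist_def)
  moreover have "ms.mcomplete"
    using uniform by (simp add: uniform_banach_space_def complex_banach_space_def)
  ultimately obtain u where u: "limitin ms.mtopology \<sigma> u sequentially"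
    unfolding ms.mcomplete_def by blast
  then have "u \<in> carr V" by (simp add: ms.limitin_metric)
  moreover have "(\<lambda>n. nrm V (\<sigma> n - u)) \<longlonglongrightarrow> 0"
  proof (rule tendstoI)
    fix e :: real assume "0 < e"
    with u have "\<forall>\<^sub>F n in sequentially. \<sigma> n \<in> carr V \<and> cdist V (\<sigma> n) u < e"
      by (simp add: ms.limitin_metric)
    then show "\<forall>\<^sub>F n in sequentially. dist (nrm V (\<sigma> n - u)) 0 < e"
      by eventually_elim (use \<open>u \<in> carr V\<close> \<sigma> in \<open>auto simp: cdist_def\<close>)
  qed
  ultimately show ?thesis using that by blast
qed

lemma modulus_of_convexity:
  assumes "0 < e"
  obtains \<delta> where "0 < \<delta>"
    "\<And>f g. f \<in> carr V \<Longrightarrow> g \<in> carr V \<Longrightarrow> nrm V f = 1 \<Longrightarrow> nrm V g = 1 \<Longrightarrow>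
       2 - \<delta> < nrm V (f + g) \<Longrightarrow> nrm V (f - g) < e"
proof -
  have "\<exists>\<delta>>0. \<forall>f\<in>carr V. \<forall>g\<in>carr V.
      nrm V f = 1 \<and> nrm V g = 1 \<and> e \<le> nrm V (f - g) \<longrightarrow> nrm V (f + g) \<le> 2 - \<delta>"
    using uniform assms unfolding uniform_banach_space_def uniformly_convex_def by blast
  then show ?thesis using that by (meson not_le)
qed

lemma unit_Cauchy_limit:
  assumes \<sigma>: "\<And>n. \<sigma> n \<in> carr V" "\<And>n. nrm V (\<sigma> n) = 1"
    and Cauchy: "\<And>e. 0 < e \<Longrightarrow> \<exists>M. \<forall>m\<ge>M. \<forall>n\<ge>M. nrm V (\<sigma> m - \<sigma> n) < e"
  obtains u where "u \<in> carr V" "nrm V u = 1" "(\<lambda>n. nrm V (\<sigma> n - u)) \<longlonglongrightarrow> 0"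
proof -
  obtain u where u: "u \<in> carr V" "(\<lambda>n. nrm V (\<sigma> n - u)) \<longlonglongrightarrow> 0"
    by (rule Cauchy_limit[OF \<sigma>(1) Cauchy])
  have "\<bar>1 - nrm V u\<bar> \<le> 0"
    by (rule tendsto_lowerbound[OF u(2)])
      (use nrm_triangle_rev[OF \<sigma>(1) u(1)] \<sigma>(2) in auto)
  with u that show ?thesis by simp
qed

text \<open>If \<open>\<phi>\<close> is almost maximal at two unit vectors, then it is almost twice
  maximal at their sum, whose norm is therefore close to 2. Uniform convexity thus makes a
  maximizing sequence Cauchy, and the maximum is attained at its limit.\<close>

lemma norming_vector_exists:
  assumes \<phi>: "\<phi> \<in> carr (dual_space V)" and pos: "0 < nrm (dual_space V) \<phi>"
  obtains u where "u \<in> carr V" "nrm V u = 1" "nrm (dual_space V) \<phi> \<le> Re (\<phi> u)"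
proof -
  define M where "M = nrm (dual_space V) \<phi>"
  have M: "M > 0" using pos by (simp add: M_def)
  have "\<exists>u. u \<in> carr V \<and> nrm V u = 1 \<and> M * (1 - 1 / Suc n) < Re (\<phi> u)" for n
  proof -
    have "M * (1 - 1 / Suc n) < M" using M by (simp add: field_simps)
    then show ?thesis using nearly_norming_vector[OF \<phi> _ pos] unfolding M_def by blast
  qed
  then obtain \<sigma> where \<sigma>: "\<And>n. \<sigma> n \<in> carr V" "\<And>n. nrm V (\<sigma> n) = 1"
      "\<And>n. M * (1 - 1 / Suc n) < Re (\<phi> (\<sigma> n))"
    by metis
  have Cauchy: "\<exists>K. \<forall>m\<ge>K. \<forall>n\<ge>K. nrm V (\<sigma> m - \<sigma> n) < e" if "0 < e" for e
  proof -
    obtain \<delta> where \<delta>: "0 < \<delta>"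
      "\<And>f g. f \<in> carr V \<Longrightarrow> g \<in> carr V \<Longrightarrow> nrm V f = 1 \<Longrightarrow> nrm V g = 1 \<Longrightarrow>
         2 - \<delta> < nrm V (f + g) \<Longrightarrow> nrm V (f - g) < e"
      using modulus_of_convexity[OF \<open>0 < e\<close>] by blast
    obtain K where K: "1 / Suc K < \<delta> / 2"
      using \<delta>(1) by (metis half_gt_zero nat_approx_posE of_nat_Suc)
    have small: "1 / Suc m < \<delta> / 2" if "m \<ge> K" for m
      using that K by (smt (verit) frac_le of_nat_0_less_iff of_nat_le_iff zero_less_Suc Suc_le_mono)
    have "nrm V (\<sigma> m - \<sigma> n) < e" if "m \<ge> K" "n \<ge> K" for m n
    proof (rule \<delta>(2))
      have "M * (2 - \<delta>) \<le> M * ((1 - 1 / Suc m) + (1 - 1 / Suc n))"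
        using small[OF that(1)] small[OF that(2)] M by (intro mult_left_mono) linarith+
      also have "\<dots> = M * (1 - 1 / Suc m) + M * (1 - 1 / Suc n)"
        by (rule distrib_left)
      also have "\<dots> < Re (\<phi> (\<sigma> m)) + Re (\<phi> (\<sigma> n))"
        by (intro add_strict_mono \<sigma>)
      also have "\<dots> = Re (\<phi> (\<sigma> m + \<sigma> n))"
        using \<sigma> by (simp add: dual_add[OF \<phi>])
      also have "\<dots> \<le> M * nrm V (\<sigma> m + \<sigma> n)"
        unfolding M_def using \<sigma> by (intro Re_dual_le \<phi>) auto
      finally show "2 - \<delta> < nrm V (\<sigma> m + \<sigma> n)"
        using M by simp
    qed (use \<sigma> in auto)
    then show ?thesis by blast
  qed
  obtain u where u: "u \<in> carr V" "nrm V u = 1" "(\<lambda>n. nrm V (\<sigma> n - u)) \<longlonglongrightarrow> 0"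
    by (rule unit_Cauchy_limit[OF \<sigma>(1,2) Cauchy])
  have "(\<lambda>n. M * (1 - 1 / Suc n) - M * nrm V (\<sigma> n - u)) \<longlonglongrightarrow> M * (1 - 0) - M * 0"
    by (intro tendsto_intros u LIMSEQ_Suc[OF lim_1_over_n])
  \<comment> \<open>Continuity of \<open>\<phi>\<close> in quantitative form: the values at
    \<open>\<sigma> n\<close> and \<open>u\<close> differ in real part by at most
    \<open>M * nrm V (\<sigma> n - u)\<close>.\<close>
  moreover have "M * (1 - 1 / Suc n) - M * nrm V (\<sigma> n - u) \<le> Re (\<phi> u)" for n
    using \<sigma>(3)[of n] Re_dual_le[OF \<phi>, of "\<sigma> n - u"] dual_diff[OF \<phi>, of "\<sigma> n" u] \<sigma>(1)[of n] u(1)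
    by (simp add: M_def)
  ultimately have "M \<le> Re (\<phi> u)"
    by (intro tendsto_upperbound[where F = sequentially]) auto
  with u that show ?thesis by (simp add: M_def)
qed

lemma duality_map_in_dual:
  assumes w: "w \<in> carr V"
  shows "duality_map V w \<in> carr (dual_space V)"
proof -
  have "\<exists>\<alpha>\<ge>0. \<forall>u\<in>carr V. cmod (sip V u w) \<le> \<alpha> * nrm V u"
    using sip_cauchy_schwarz[OF _ w] w
    by (intro exI[of _ "nrm V w"]) (auto simp: mult.commute)
  then show ?thesis
    using w by (auto simp: carr_dual_iff duality_map_def sip_add_left sip_scl_left)
qed

text \<open>At a norming unit vector \<open>u\<close>, the bound
  \<open>M + t Re (\<phi> g) \<le> M * nrm V (u + t g)\<close> identifies the real part of
  \<open>\<phi>\<close> with \<open>M * gder u\<close>, hence with that of \<open>M [g, u]\<close>.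
  As \<open>M\<close> is real, it moves into the second variable unchanged. The zero functional has
  no norming direction and is represented by 0.\<close>

lemma sip_representative_exists:
  assumes \<phi>: "\<phi> \<in> carr (dual_space V)"
  obtains w where "w \<in> carr V" "\<And>u. u \<in> carr V \<Longrightarrow> \<phi> u = sip V u w"
proof (cases "nrm (dual_space V) \<phi> = 0")
  case True
  then have "\<phi> u = sip V u 0" if "u \<in> carr V" for u
    using dual_bound[OF \<phi> that] that by (simp add: sip_zero_right)
  then show ?thesis using that carr_zero by blast
next
  case False
  define M where "M = nrm (dual_space V) \<phi>"
  have M: "0 < M" using False nrm_dual_nonneg[OF \<phi>] by (simp add: M_def)
  obtain u where u: "u \<in> carr V" "nrm V u = 1" "M \<le> Re (\<phi> u)"
    using norming_vector_exists[OF \<phi>] M unfolding M_def by blast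
  have [simp]: "u \<noteq> 0" using u(2) by auto
  have Re: "Re (\<phi> g) = M * gder u g" if g: "g \<in> carr V" for g
  proof (rule gder_unique)
    fix t :: real
    have "M + t * Re (\<phi> g) \<le> Re (\<phi> (u + scl V (of_real t) g))"
      using u g by (simp add: dual_add[OF \<phi>] dual_scl[OF \<phi>])
    also have "\<dots> \<le> M * nrm V (u + scl V (of_real t) g)"
      unfolding M_def using u g by (intro Re_dual_le[OF \<phi>]) auto
    finally show "t * Re (\<phi> g) \<le> M * (nrm V (u + scl V (of_real t) g) - nrm V u)"
      using u by (simp add: algebra_simps)
  qed (use u g in auto)
  have Re': "Re (\<phi> g) = M * Re (sip V g u)" if g: "g \<in> carr V" for g
    using Re[OF g] Re_csip_eq[OF compatible_sip_sip u(1) _ g] u(2) by simp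
  have "\<phi> g = sip V g (scl V (of_real M) u)" if g: "g \<in> carr V" for g
    using Re'[OF g] Re'[OF carr_scl[OF g], of \<i>] u g
    by (simp add: complex_eq_iff dual_scl[OF \<phi>] sip_scl_left sip_scl_right)
  then show ?thesis using that u(1) carr_scl by blast
qed

text \<open>Cauchy-Schwarz forces equal norms \<open>r\<close>. Then
  \<open>[v + w, w] = 2 r^2\<close> forces the normalized vectors to have a sum of norm at least 2,
  and uniform convexity puts them at distance below every positive \<open>e\<close>.\<close>

lemma sip_representative_unique:
  assumes v: "v \<in> carr V" and w: "w \<in> carr V"
    and eq: "\<And>u. u \<in> carr V \<Longrightarrow> sip V u v = sip V u w"
  shows "v = w"
proof -
  have le: "nrm V v \<le> nrm V w" if "v \<in> carr V" "w \<in> carr V"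
    "\<And>u. u \<in> carr V \<Longrightarrow> sip V u v = sip V u w" for v w
  proof (cases "v = 0")
    case False
    have "(nrm V v)\<^sup>2 = cmod (sip V v w)"
      using sip_self[OF that(1)] that(3)[OF that(1)] by (metis abs_power2 norm_of_real)
    also have "\<dots> \<le> nrm V v * nrm V w" by (rule sip_cauchy_schwarz[OF that(1,2)])
    finally show ?thesis
      using nrm_pos[OF that(1) False] by (simp add: power2_eq_square)
  qed (use that in auto)
  have n: "nrm V v = nrm V w" using le[OF v w eq] le[OF w v eq[symmetric]] by simp
  show ?thesis
  proof (cases "w = 0")
    case True
    then show ?thesis using n v by simp
  next
    case False
    define r where "r = nrm V w"
    have r: "0 < r" using nrm_pos[OF w False] by (simp add: r_def)
    let ?c = "of_real (inverse r)"
    have unit: "nrm V (scl V ?c v) = 1" "nrm V (scl V ?c w) = 1"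
      using r v w n by (auto simp: r_def[symmetric] norm_inverse)
    have "sip V (v + w) w = of_real (2 * r\<^sup>2)"
      using v w sip_self[OF v] sip_self[OF w] eq[OF v] n by (simp add: sip_add_left r_def)
    then have "2 * r\<^sup>2 \<le> nrm V (v + w) * r"
      using sip_cauchy_schwarz[OF carr_add[OF v w] w] r
      by (metis abs_of_nonneg mult_nonneg_nonneg norm_of_real r_def zero_le_numeral zero_le_power2)
    then have "2 * r \<le> nrm V (v + w)" using r by (simp add: power2_eq_square mult.assoc[symmetric])
    moreover have "nrm V (scl V ?c v + scl V ?c w) = nrm V (v + w) / r"
      using nrm_scl[OF carr_add[OF v w], of ?c] r
      by (simp add: vs.scale_right_distrib norm_inverse divide_inverse mult.commute)
    ultimately have two: "2 \<le> nrm V (scl V ?c v + scl V ?c w)"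
      using r by (simp only: pos_le_divide_eq)
    have "nrm V (scl V ?c v - scl V ?c w) < e" if "0 < e" for e
    proof -
      obtain \<delta> where \<delta>: "0 < \<delta>"
        "\<And>f g. f \<in> carr V \<Longrightarrow> g \<in> carr V \<Longrightarrow> nrm V f = 1 \<Longrightarrow> nrm V g = 1 \<Longrightarrow>
           2 - \<delta> < nrm V (f + g) \<Longrightarrow> nrm V (f - g) < e"
        using modulus_of_convexity[OF \<open>0 < e\<close>] by blast
      show ?thesis by (rule \<delta>(2)) (use v w unit two \<delta>(1) in auto)
    qed
    then have "nrm V (scl V ?c v - scl V ?c w) \<le> 0"
      by (meson less_irrefl not_le)
    moreover have "scl V ?c v - scl V ?c w \<in> carr V" using v w by blast
    ultimately have "scl V ?c v - scl V ?c w = 0"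
      using nrm_nonneg nrm_eq_0_iff by (metis order_antisym)
    then show ?thesis using r by simp
  qed
qed

end

text \<open>The map sending \<open>u\<close> to \<open>[T u, v]\<close> is a bounded functional on
  \<open>W\<close>, so it has a unique representative; this legitimizes the definite description in
  \<open>gen_adjoint\<close>.\<close>

lemma gen_adjoint_characterization:
  assumes W: "uniform_banach_space W" and L: "uniform_banach_space L"
    and T: "T \<in> bdd_lin_maps W L" and v: "v \<in> carr L"
  shows "gen_adjoint W L T v \<in> carr W"
    and "u \<in> carr W \<Longrightarrow> sip W u (gen_adjoint W L T v) = sip L (T u) v"
proof -
  interpret W: unif_space W using W by (simp add: unif_space_iff)
  interpret L: unif_space L using L by (simp add: unif_space_iff)
  have T_carr: "T u \<in> carr L" if "u \<in> carr W" for u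
    using T that by (auto simp: bdd_lin_maps_def bdd_maps_def)
  obtain \<alpha> where \<alpha>: "0 \<le> \<alpha>" "\<And>u. u \<in> carr W \<Longrightarrow> nrm L (T u) \<le> \<alpha> * nrm W u"
    using T by (auto simp: bdd_lin_maps_def bdd_maps_def)
  let ?\<phi> = "\<lambda>u. if u \<in> carr W then sip L (T u) v else 0"
  have "cmod (sip L (T u) v) \<le> (\<alpha> * nrm L v) * nrm W u" if "u \<in> carr W" for u
    using L.sip_cauchy_schwarz[OF T_carr[OF that] v] mult_right_mono[OF \<alpha>(2)[OF that], of "nrm L v"] v
    by (simp add: mult.commute mult.left_commute)
  moreover have "0 \<le> \<alpha> * nrm L v" using \<alpha>(1) v by simp
  ultimately have "\<exists>\<alpha>\<ge>0. \<forall>u\<in>carr W. cmod (sip L (T u) v) \<le> \<alpha> * nrm W u" by blast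
  then have "?\<phi> \<in> carr (dual_space W)"
    using T T_carr v
    by (auto simp: W.carr_dual_iff bdd_lin_maps_def L.sip_add_left L.sip_scl_left)
  then obtain w where w: "w \<in> carr W" "\<And>u. u \<in> carr W \<Longrightarrow> ?\<phi> u = sip W u w"
    using W.sip_representative_exists by blast
  have "\<exists>!w. w \<in> carr W \<and> (\<forall>u\<in>carr W. sip L (T u) v = sip W u w)"
    using w by (intro ex1I[of _ w]) (auto intro: W.sip_representative_unique)
  from theI'[OF this]
  show "gen_adjoint W L T v \<in> carr W"
    and "u \<in> carr W \<Longrightarrow> sip W u (gen_adjoint W L T v) = sip L (T u) v"
    by (auto simp: gen_adjoint_def)
qed

lemma gen_adjoint_eqI:
  assumes W: "uniform_banach_space W" and w: "w \<in> carr W"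
    and eq: "\<And>u. u \<in> carr W \<Longrightarrow> sip L (T u) v = sip W u w"
  shows "gen_adjoint W L T v = w"
proof -
  interpret W: unif_space W using W by (simp add: unif_space_iff)
  show ?thesis
    unfolding gen_adjoint_def
    by (rule the_equality) (use w eq in \<open>auto intro: W.sip_representative_unique\<close>)
qed

section \<open>Dense subspaces of the dual\<close>

context unif_space
begin

text \<open>This takes the place of a Hahn-Banach functional on the dual, with the annihilating
  element found in \<open>V\<close> itself. The point \<open>w\<close> is the limit of a sequence
  running through the shrinking sets \<open>A e\<close>.\<close>

lemma common_zero_of_nondense_subspace:
  assumes S: "module.subspace (scl (dual_space V)) S" "S \<subseteq> carr (dual_space V)"
    and \<phi>: "\<phi> \<in> carr (dual_space V)"
    and r: "0 < r" "\<And>s. s \<in> S \<Longrightarrow> r \<le> nrm (dual_space V) (\<phi> - s)"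
  obtains w where "w \<in> carr V" "nrm V w = 1" "\<And>s. s \<in> S \<Longrightarrow> s w = 0"
proof -
  interpret dual: cnorm_space "dual_space V"
    by unfold_locales (rule complex_normed_space_dual)
  let ?n = "nrm (dual_space V)"
  have S_dual: "\<phi> - s \<in> carr (dual_space V)" if "s \<in> S" for s
    using \<phi> S(2) that by blast
  define d where "d = (INF s\<in>S. ?n (\<phi> - s))"
  have ne: "S \<noteq> {}" using dual.vs.subspace_0[OF S(1)] by blast
  have "r \<le> d" unfolding d_def using r(2) by (rule cINF_greatest[OF ne])
  with r(1) have d_pos: "0 < d" by simp
  have d_le: "d \<le> ?n (\<phi> - s)" if "s \<in> S" for s
    unfolding d_def using r by (intro cINF_lower[OF _ that]) (auto intro!: bdd_belowI)
  have near: "\<exists>s\<in>S. ?n (\<phi> - s) < d + e" if "0 < e" for e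
  proof (rule ccontr)
    assume "\<not> ?thesis"
    then have "d + e \<le> d"
      unfolding d_def by (intro cINF_greatest[OF ne]) (auto simp: not_less)
    with that show False by simp
  qed
  have test: "\<exists>u. u \<in> carr V \<and> nrm V u = 1 \<and> d - e < Re (\<phi> u - s u)"
    if "s \<in> S" "0 < e" for s e
  proof -
    have "d - e < ?n (\<phi> - s)" "0 < ?n (\<phi> - s)"
      using d_le[OF that(1)] d_pos that(2) by linarith+
    then obtain u where "u \<in> carr V" "nrm V u = 1" "d - e < Re ((\<phi> - s) u)"
      using nearly_norming_vector[OF S_dual[OF \<open>s \<in> S\<close>]] by blast
    then show ?thesis by auto
  qed
  \<comment> \<open>\<open>A e\<close> collects the unit vectors at which some
    \<open>\<phi> - s\<close> of norm within \<open>e\<close> of the distance \<open>d\<close> is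
    itself within \<open>e\<close> of \<open>d\<close>. These sets shrink with \<open>e\<close>, are
    nonempty, and have diameters tending to 0.\<close>
  define A where "A e = {w \<in> carr V. nrm V w = 1 \<and>
    (\<exists>s\<in>S. ?n (\<phi> - s) < d + e \<and> d - e < Re (\<phi> w - s w))}" for e
  have A_mono: "A e \<subseteq> A e'" if "e \<le> e'" for e e'
  proof
    fix w assume "w \<in> A e"
    then obtain s where "s \<in> S" "?n (\<phi> - s) < d + e" "d - e < Re (\<phi> w - s w)"
      and w: "w \<in> carr V" "nrm V w = 1"
      unfolding A_def by blast
    then have "\<exists>s\<in>S. ?n (\<phi> - s) < d + e' \<and> d - e' < Re (\<phi> w - s w)"
      using that by (intro bexI[of _ s]) auto
    with w show "w \<in> A e'" unfolding A_def by blast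
  qed
  have A_ne: "\<exists>w. w \<in> A e" if "0 < e" for e
    using near[OF that] test[OF _ that] unfolding A_def by blast
  have diam: "\<exists>e>0. \<forall>v\<in>A e. \<forall>w\<in>A e. nrm V (v - w) < \<eta>" if "0 < \<eta>" for \<eta>
  proof -
    obtain \<delta> where \<delta>: "0 < \<delta>"
      "\<And>f g. f \<in> carr V \<Longrightarrow> g \<in> carr V \<Longrightarrow> nrm V f = 1 \<Longrightarrow> nrm V g = 1 \<Longrightarrow>
         2 - \<delta> < nrm V (f + g) \<Longrightarrow> nrm V (f - g) < \<eta> / 2"
      using modulus_of_convexity[of "\<eta> / 2"] \<open>0 < \<eta>\<close> by (metis half_gt_zero)
    \<comment> \<open>With \<open>\<delta> * d = 7 * e\<close> the product
      \<open>(d + e) * (2 - \<delta>)\<close> equals \<open>2 * d - 5 * e - \<delta> * e\<close>,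
      which is below the bound \<open>2 * d - 4 * e\<close> obtained in
      \<open>close\<close>.\<close>
    define e where "e = \<delta> * d / 7"
    have e: "0 < e" using \<delta>(1) d_pos by (simp add: e_def)
    have close: "nrm V (u - v) < \<eta> / 2"
      if s: "s \<in> S" "?n (\<phi> - s) < d + e"
        and u: "u \<in> carr V" "nrm V u = 1" "d - 3 * e < Re (\<phi> u - s u)"
        and v: "v \<in> carr V" "nrm V v = 1" "d - e < Re (\<phi> v - s v)" for s u v
    proof (rule \<delta>(2))
      have "2 * d - 4 * e < Re ((\<phi> - s) (u + v))"
        using u v dual_add[OF S_dual[OF s(1)] u(1) v(1)] by simp
      also have "\<dots> \<le> ?n (\<phi> - s) * nrm V (u + v)"
        using u v by (intro Re_dual_le S_dual s) auto
      also have "\<dots> \<le> (d + e) * nrm V (u + v)"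
        using s u v by (intro mult_right_mono) auto
      finally have *: "2 * d - 4 * e < (d + e) * nrm V (u + v)" .
      have "(d + e) * (2 - \<delta>) \<le> 2 * d - 4 * e"
      proof -
        have "7 * e = \<delta> * d" "0 \<le> \<delta> * e" using \<delta>(1) e by (auto simp: e_def)
        then show ?thesis using e by (simp add: algebra_simps)
      qed
      with * have "(d + e) * (2 - \<delta>) < (d + e) * nrm V (u + v)" by linarith
      then show "2 - \<delta> < nrm V (u + v)" using d_pos e by simp
    qed (use u v in auto)
    have "nrm V (v - w) < \<eta>" if v: "v \<in> A e" and w: "w \<in> A e" for v w
    proof -
      obtain s where s: "s \<in> S" "?n (\<phi> - s) < d + e" "d - e < Re (\<phi> v - s v)"
        using v unfolding A_def by blast
      obtain s' where s': "s' \<in> S" "?n (\<phi> - s') < d + e" "d - e < Re (\<phi> w - s' w)"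
        using w unfolding A_def by blast
      have carr: "v \<in> carr V" "w \<in> carr V" "nrm V v = 1" "nrm V w = 1"
        using v w unfolding A_def by auto
      \<comment> \<open>Two members of \<open>A e\<close> may come from different \<open>s\<close>
        and \<open>s'\<close>. A vector \<open>u\<close> nearly norming \<open>\<phi> - m\<close> at
        their midpoint \<open>m\<close> nearly norms both differences: their values at
        \<open>u\<close> sum to more than \<open>2 * d - 2 * e\<close> and each is below
        \<open>d + e\<close>, so each exceeds \<open>d - 3 * e\<close>. Hence \<open>u\<close> is
        close to both vectors.\<close>
      define m where "m = scl (dual_space V) (1/2) (s + s')"
      have "m \<in> S"
        unfolding m_def using s s' by (intro dual.vs.subspace_scale[OF S(1)] dual.vs.subspace_add[OF S(1)])
      then obtain u where u: "u \<in> carr V" "nrm V u = 1" "d - e < Re (\<phi> u - m u)"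
        using test e by blast
      have sum: "2 * d - 2 * e < Re (\<phi> u - s u) + Re (\<phi> u - s' u)"
        using u(3) by (simp add: m_def field_simps)
      have "Re (\<phi> u - s u) \<le> ?n (\<phi> - s)" "Re (\<phi> u - s' u) \<le> ?n (\<phi> - s')"
        using Re_dual_le[OF S_dual[OF s(1)] u(1)] Re_dual_le[OF S_dual[OF s'(1)] u(1)] u(2) by auto
      then have "d - 3 * e < Re (\<phi> u - s u)" "d - 3 * e < Re (\<phi> u - s' u)"
        using sum s(2) s'(2) by linarith+
      then have "nrm V (u - v) < \<eta> / 2" "nrm V (u - w) < \<eta> / 2"
        using close[OF s(1,2) u(1,2) _ carr(1,3) s(3)] close[OF s'(1,2) u(1,2) _ carr(2,4) s'(3)] by auto
      then show ?thesis
        using nrm_triangle_diff[OF carr(1) u(1) carr(2)] nrm_diff_commute[OF carr(1) u(1)] by linarith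
    qed
    then show ?thesis using e by blast
  qed
  have "\<exists>w. w \<in> A (1 / Suc n)" for n by (rule A_ne) simp
  then obtain \<sigma> where \<sigma>: "\<And>n. \<sigma> n \<in> A (1 / Suc n)" by metis
  have \<sigma>_carr: "\<sigma> n \<in> carr V" "nrm V (\<sigma> n) = 1" for n
    using \<sigma>[of n] by (auto simp: A_def)
  have \<sigma>_tail: "\<exists>K. \<forall>n\<ge>K. \<sigma> n \<in> A e" if "0 < e" for e
  proof -
    obtain K where K: "1 / Suc K < e"
      using \<open>0 < e\<close> by (metis nat_approx_posE of_nat_Suc)
    have "\<sigma> n \<in> A e" if "K \<le> n" for n
    proof -
      have "1 / Suc n \<le> 1 / Suc K" using that by (simp add: frac_le)
      then show ?thesis using \<sigma>[of n] A_mono[of "1 / Suc n" e] K by auto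
    qed
    then show ?thesis by blast
  qed
  have Cauchy: "\<exists>K. \<forall>m\<ge>K. \<forall>n\<ge>K. nrm V (\<sigma> m - \<sigma> n) < \<eta>" if "0 < \<eta>" for \<eta>
    using diam[OF that] \<sigma>_tail by meson
  obtain w where w: "w \<in> carr V" "nrm V w = 1" "(\<lambda>n. nrm V (\<sigma> n - w)) \<longlonglongrightarrow> 0"
    by (rule unit_Cauchy_limit[OF \<sigma>_carr Cauchy])
  have A_close: "\<exists>e>0. \<forall>v\<in>A e. nrm V (v - w) < \<eta>" if "0 < \<eta>" for \<eta>
  proof -
    obtain e where e: "0 < e" "\<And>u v. u \<in> A e \<Longrightarrow> v \<in> A e \<Longrightarrow> nrm V (u - v) < \<eta> / 2"
      using diam[of "\<eta> / 2"] \<open>0 < \<eta>\<close> by (metis half_gt_zero)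
    obtain K where K: "\<And>n. n \<ge> K \<Longrightarrow> \<sigma> n \<in> A e" using \<sigma>_tail[OF e(1)] by blast
    have "\<forall>\<^sub>F n in sequentially. nrm V (\<sigma> n - w) < \<eta> / 2"
      by (rule order_tendstoD(2)[OF w(3)]) (use \<open>0 < \<eta>\<close> in simp)
    then have "\<forall>\<^sub>F n in sequentially. \<sigma> n \<in> A e \<and> nrm V (\<sigma> n - w) < \<eta> / 2"
      using eventually_ge_at_top[of K] by eventually_elim (use K in auto)
    then obtain n where n: "\<sigma> n \<in> A e" "nrm V (\<sigma> n - w) < \<eta> / 2"
      by (auto simp: eventually_sequentially)
    have "nrm V (v - w) < \<eta>" if v: "v \<in> A e" for v
    proof -
      have "v \<in> carr V" using v by (simp add: A_def)
      then show ?thesis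
        using nrm_triangle_diff[OF _ \<sigma>_carr(1)[of n] w(1), of v] e(2)[OF v n(1)] n(2) by simp
    qed
    with e(1) show ?thesis by blast
  qed
  \<comment> \<open>A one-sided bound suffices, as \<open>S\<close> is closed under complex
    multiples: applied to \<open>- cnj (s w)\<close> times \<open>s\<close> it gives
    \<open>(cmod (s w))^2 \<le> 0\<close>.\<close>
  have nonneg: "0 \<le> Re (s w)" if s: "s \<in> S" for s
  proof (rule ccontr)
    assume neg: "\<not> ?thesis"
    define \<kappa> where "\<kappa> = - Re (s w)"
    have \<kappa>: "0 < \<kappa>" using neg by (simp add: \<kappa>_def)
    have s_dual: "s \<in> carr (dual_space V)" using s S(2) by blast
    define \<rho> where "\<rho> = ?n s + 1"
    have \<rho>: "0 < \<rho>" "?n s \<le> \<rho>" using nrm_dual_nonneg[OF s_dual] by (auto simp: \<rho>_def)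
    obtain e where e: "0 < e" "\<And>v. v \<in> A e \<Longrightarrow> nrm V (v - w) < \<kappa> / (2 * \<rho>)"
      using A_close[of "\<kappa> / (2 * \<rho>)"] \<kappa> \<rho>(1) by auto
    \<comment> \<open>Since \<open>t * \<rho> = e / 2\<close>, adding \<open>t s\<close> changes
      values at unit vectors by at most \<open>e / 2\<close>, and \<open>e' \<le> e / 2\<close>
      leaves room to stay in \<open>A e\<close>. The bound \<open>e' \<le> t * \<kappa> / 4\<close>
      turns the total slack \<open>2 * e'\<close> into at most
      \<open>t * \<kappa> / 2\<close>.\<close>
    define t where "t = e / (2 * \<rho>)"
    have t: "0 < t" "t * \<rho> = e / 2" using e(1) \<rho>(1) by (auto simp: t_def)
    define e' where "e' = min (e / 2) (t * \<kappa> / 4)"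
    have e': "0 < e'" "e' \<le> e / 2" "e' \<le> t * \<kappa> / 4" using e(1) t(1) \<kappa> by (auto simp: e'_def)
    obtain p where p: "p \<in> S" "?n (\<phi> - p) < d + e'" using near[OF e'(1)] by blast
    \<comment> \<open>A vector almost norming \<open>\<phi> - p + t s\<close> also almost norms \<open>\<phi> - p\<close>, so it is close to \<open>w\<close>.\<close>
    have "p - scl (dual_space V) (of_real t) s \<in> S"
      using p(1) s by (intro dual.vs.subspace_diff[OF S(1)] dual.vs.subspace_scale[OF S(1)])
    then obtain v where v: "v \<in> carr V" "nrm V v = 1" "d - e' < Re (\<phi> v - (p - scl (dual_space V) (of_real t) s) v)"
      using test e'(1) by blast
    have split: "d - e' < Re (\<phi> v - p v) + t * Re (s v)"
      using v(3) by (simp add: algebra_simps)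
    have "Re (s v) \<le> \<rho>" using Re_dual_le[OF s_dual v(1)] v(2) \<rho>(2) by simp
    then have "t * Re (s v) \<le> e / 2" using mult_left_mono[of "Re (s v)" \<rho> t] t by simp
    with split e' have "d - e < Re (\<phi> v - p v)" by linarith
    with p v e' have "v \<in> A e"
      unfolding A_def using e(1) by (auto intro!: bexI[of _ p])
    then have vw: "nrm V (v - w) < \<kappa> / (2 * \<rho>)" by (rule e(2))
    have "Re (\<phi> v - p v) \<le> ?n (\<phi> - p)"
      using Re_dual_le[OF S_dual[OF p(1)] v(1)] v(2) by simp
    with split p(2) have "- 2 * e' < t * Re (s v)" by linarith
    with e'(3) have "t * (- \<kappa> / 2) < t * Re (s v)" by simp
    then have sv: "- \<kappa> / 2 < Re (s v)" using t(1) by (simp only: mult_less_cancel_left_pos)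
    \<comment> \<open>The contradiction: \<open>Re (s v)\<close> exceeds
      \<open>- \<kappa> / 2\<close> while \<open>Re (s w)\<close> is \<open>- \<kappa>\<close>, yet
      \<open>v\<close> is too close to \<open>w\<close> for a gap of
      \<open>\<kappa> / 2\<close>.\<close>
    have "Re (s v) - Re (s w) = Re (s (v - w))"
      using dual_diff[OF s_dual v(1) w(1)] by simp
    also have "\<dots> \<le> ?n s * nrm V (v - w)"
      using v w by (intro Re_dual_le s_dual) auto
    also have "\<dots> \<le> \<rho> * nrm V (v - w)"
      using \<rho> v w by (intro mult_right_mono) auto
    also have "\<dots> < \<rho> * (\<kappa> / (2 * \<rho>))"
      using vw \<rho>(1) by (intro mult_strict_left_mono)
    also have "\<dots> = \<kappa> / 2" using \<rho>(1) by simp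
    finally show False using sv by (simp add: \<kappa>_def)
  qed
  have "s w = 0" if s: "s \<in> S" for s
  proof -
    have "0 \<le> Re (a * s w)" for a
      using nonneg[OF dual.vs.subspace_scale[OF S(1) s, of a]] by simp
    from this[of "- cnj (s w)"] have "(cmod (s w))\<^sup>2 \<le> 0"
      unfolding cmod_power2 by (simp add: power2_eq_square algebra_simps)
    then show ?thesis by simp
  qed
  with w that show ?thesis by blast
qed

text \<open>A functional outside the closure has a ball around it that misses the span, so
  \<open>common_zero_of_nondense_subspace\<close> yields a unit vector annihilated by
  \<open>S\<close>, against separation.\<close>

lemma closed_span_dual_eq_carr:
  assumes S: "S \<subseteq> carr (dual_space V)"
    and separating: "\<And>w. w \<in> carr V \<Longrightarrow> (\<And>s. s \<in> S \<Longrightarrow> s w = 0) \<Longrightarrow> w = 0"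
  shows "closed_span (dual_space V) S = carr (dual_space V)"
proof -
  interpret dual: cnorm_space "dual_space V"
    by unfold_locales (rule complex_normed_space_dual)
  have span: "dual.vs.span S \<subseteq> carr (dual_space V)"
    using S dual.subspace_carr by (rule dual.vs.span_minimal)
  have "\<phi> \<in> closed_span (dual_space V) S" if \<phi>: "\<phi> \<in> carr (dual_space V)" for \<phi>
  proof (rule ccontr)
    assume "\<phi> \<notin> closed_span (dual_space V) S"
    then obtain r where r: "0 < r" "\<And>s. s \<in> dual.vs.span S \<Longrightarrow> s \<notin> dual.ms.mball \<phi> r"
      using \<phi> unfolding closed_span_def dual.ms.metric_closure_of by blast
    have "r \<le> nrm (dual_space V) (\<phi> - s)" if "s \<in> dual.vs.span S" for s
      using r(2)[OF that] \<phi> span that by (auto simp: dual.ms.in_mball cdist_def)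
    then obtain w where w: "w \<in> carr V" "nrm V w = 1" "\<And>s. s \<in> dual.vs.span S \<Longrightarrow> s w = 0"
      using common_zero_of_nondense_subspace[OF dual.vs.subspace_span span \<phi> r(1)] by metis
    then have "w = 0" using separating[OF w(1)] dual.vs.span_base by blast
    with w(2) show False by simp
  qed
  moreover have "closed_span (dual_space V) S \<subseteq> carr (dual_space V)"
    unfolding closed_span_def dual.ms.metric_closure_of by blast
  ultimately show ?thesis by blast
qed

end

text \<open>Vanishing at \<open>u\<close> passes from \<open>S\<close> to its span and, by
  approximation in the dual norm, to the closure. The tolerance is \<open>r / (nrm V u + 1)\<close>,
  whose denominator is positive even for \<open>u = 0\<close>.\<close>

lemma (in cnorm_space) closed_span_dual_separates:
  assumes dense: "closed_span (dual_space V) S = carr (dual_space V)"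
    and S: "S \<subseteq> carr (dual_space V)"
    and u: "u \<in> carr V" and zero: "\<And>s. s \<in> S \<Longrightarrow> s u = 0"
    and \<phi>: "\<phi> \<in> carr (dual_space V)"
  shows "\<phi> u = 0"
proof -
  interpret dual: cnorm_space "dual_space V"
    by unfold_locales (rule complex_normed_space_dual)
  have span: "dual.vs.span S \<subseteq> carr (dual_space V)"
    using S dual.subspace_carr by (rule dual.vs.span_minimal)
  have zero_span: "s u = 0" if "s \<in> dual.vs.span S" for s
    using that by (induction rule: dual.vs.span_induct_alt) (auto simp: zero)
  have "cmod (\<phi> u) \<le> 0 + r" if r: "0 < r" for r
  proof -
    define q where "q = r / (nrm V u + 1)"
    have q: "0 < q" "q * nrm V u \<le> r"
      using r nrm_nonneg[OF u] by (auto simp: q_def field_simps add_pos_nonneg add_nonneg_pos)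
    have "\<phi> \<in> closed_span (dual_space V) S" by (simp only: dense \<phi>)
    then obtain s where s: "s \<in> dual.vs.span S" "s \<in> dual.ms.mball \<phi> q"
      using q(1) unfolding closed_span_def dual.ms.metric_closure_of by blast
    then have n: "nrm (dual_space V) (\<phi> - s) < q" "\<phi> - s \<in> carr (dual_space V)"
      by (auto simp: dual.ms.in_mball cdist_def)
    have "cmod (\<phi> u) = cmod ((\<phi> - s) u)" using zero_span[OF s(1)] by simp
    also have "\<dots> \<le> nrm (dual_space V) (\<phi> - s) * nrm V u" by (rule dual_bound[OF n(2) u])
    also have "\<dots> \<le> q * nrm V u" using n(1) u by (intro mult_right_mono) auto
    finally show ?thesis using q(2) by simp
  qed
  then have "cmod (\<phi> u) \<le> 0" by (rule field_le_epsilon)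
  then show ?thesis by simp
qed

section \<open>Reproducing kernels and feature maps\<close>

text \<open>This and \<open>bdd_lin_maps_imp_continuous\<close> mediate between the topological
  continuity of evaluations in \<open>rkbs\<close> and the norm bounds in
  \<open>feature_representation\<close>.\<close>

lemma continuous_linear_imp_bounded:
  assumes V: "complex_normed_space V" and W: "complex_normed_space W"
    and add: "\<And>u v. u \<in> carr V \<Longrightarrow> v \<in> carr V \<Longrightarrow> T (u + v) = T u + T v"
    and scl: "\<And>a u. u \<in> carr V \<Longrightarrow> T (scl V a u) = scl W a (T u)"
    and cont: "continuous_map (ctopology V) (ctopology W) T"
  shows "T \<in> bdd_lin_maps V W"
proof -
  interpret V: cnorm_space V by unfold_locales (rule V)
  interpret W: cnorm_space W by unfold_locales (rule W)
  have cont': "T ` carr V \<subseteq> carr W"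
    "\<And>a e. a \<in> carr V \<Longrightarrow> 0 < e \<Longrightarrow>
      \<exists>d>0. \<forall>x. x \<in> carr V \<and> cdist V a x < d \<longrightarrow> cdist W (T a) (T x) < e"
    using cont unfolding V.ms.metric_continuous_map[OF W.ms.Metric_space_axioms] by auto
  have T_carr: "T u \<in> carr W" if "u \<in> carr V" for u using cont'(1) that by blast
  have T0: "T 0 = 0" using scl[of 0 0] by simp
  obtain d where d: "0 < d" "\<And>x. x \<in> carr V \<Longrightarrow> nrm V x < d \<Longrightarrow> nrm W (T x) < 1"
    using cont'(2)[of 0 1] T_carr by (auto simp: T0 cdist_def)
  have "nrm W (T u) \<le> (2 / d) * nrm V u" if u: "u \<in> carr V" for u
  proof (cases "u = 0")
    case True
    then show ?thesis by (simp add: T0)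
  next
    case False
    define c where "c = d / (2 * nrm V u)"
    have n: "0 < nrm V u" using V.nrm_pos[OF u False] .
    have c: "0 < c" "c * nrm V u < d" using d(1) n by (auto simp: c_def)
    have "nrm W (T (scl V (of_real c) u)) < 1"
      by (rule d(2)) (use u c in auto)
    then have "c * nrm W (T u) < 1" using scl[OF u] T_carr[OF u] c(1) by simp
    then show ?thesis using d(1) n by (simp add: c_def field_simps)
  qed
  moreover have "0 \<le> 2 / d" using d(1) by simp
  ultimately show ?thesis
    using T_carr add scl unfolding bdd_lin_maps_def bdd_maps_def by blast
qed

lemma bdd_lin_maps_imp_continuous:
  assumes V: "complex_normed_space V" and W: "complex_normed_space W"
    and T: "T \<in> bdd_lin_maps V W"
  shows "continuous_map (ctopology V) (ctopology W) T"
proof -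
  interpret V: cnorm_space V by unfold_locales (rule V)
  interpret W: cnorm_space W by unfold_locales (rule W)
  have T_carr: "T u \<in> carr W" if "u \<in> carr V" for u
    using T that by (auto simp: bdd_lin_maps_def bdd_maps_def)
  have T_diff: "T (u - v) = T u - T v" if "u \<in> carr V" "v \<in> carr V" for u v
  proof -
    have "T ((u - v) + v) = T (u - v) + T v"
      using T V.carr_diff[OF that] that unfolding bdd_lin_maps_def by blast
    then show ?thesis by (simp add: eq_diff_eq)
  qed
  obtain \<alpha> where \<alpha>: "0 \<le> \<alpha>" "\<And>u. u \<in> carr V \<Longrightarrow> nrm W (T u) \<le> \<alpha> * nrm V u"
    using T by (auto simp: bdd_lin_maps_def bdd_maps_def)
  have "\<exists>d>0. \<forall>v. v \<in> carr V \<and> cdist V u v < d \<longrightarrow> cdist W (T u) (T v) < e"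
    if u: "u \<in> carr V" and e: "0 < e" for u e
  proof (intro exI[of _ "e / (\<alpha> + 1)"] conjI allI impI)
    show "0 < e / (\<alpha> + 1)" using e \<alpha>(1) by simp
    fix v assume v: "v \<in> carr V \<and> cdist V u v < e / (\<alpha> + 1)"
    have "nrm W (T (u - v)) \<le> \<alpha> * nrm V (u - v)" using \<alpha>(2) u v by blast
    also have "\<dots> \<le> (\<alpha> + 1) * nrm V (u - v)" using u v by (simp add: algebra_simps)
    also have "\<dots> < e" using u v \<alpha>(1) by (auto simp: cdist_def pos_less_divide_eq mult.commute)
    finally show "cdist W (T u) (T v) < e" using T_carr T_diff u v by (simp add: cdist_def)
  qed
  then show ?thesis
    unfolding V.ms.metric_continuous_map[OF W.ms.Metric_space_axioms] using T_carr by blast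
qed

text \<open>Completeness, convexity and differentiability involve only the norm and the linear
  operations, so they travel along a linear isometry. It will be applied to the embedding of
  \<open>W\<close> into functions on \<open>X\<close>.\<close>

lemma uniform_banach_space_isometric_image:
  assumes V: "uniform_banach_space V" and vs: "vector_space (scl B)"
    and carr: "carr B = \<iota> ` carr V"
    and add: "\<And>u v. u \<in> carr V \<Longrightarrow> v \<in> carr V \<Longrightarrow> \<iota> (u + v) = \<iota> u + \<iota> v"
    and scl: "\<And>a u. u \<in> carr V \<Longrightarrow> \<iota> (scl V a u) = scl B a (\<iota> u)"
    and nrm: "\<And>u. u \<in> carr V \<Longrightarrow> nrm B (\<iota> u) = nrm V u"
  shows "uniform_banach_space B"
proof -
  interpret V: unif_space V using V by (simp add: unif_space_iff)
  interpret vsB: vector_space "scl B" by (rule vs)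
  have zero: "\<iota> 0 = 0" using add[of 0 0] by simp
  have diff: "\<iota> (u - v) = \<iota> u - \<iota> v" if "u \<in> carr V" "v \<in> carr V" for u v
    using add[of "u - v" v] that by (simp add: eq_diff_eq)
  have eq_0: "\<iota> u = 0 \<longleftrightarrow> u = 0" if "u \<in> carr V" for u
    using nrm[OF that] nrm[of 0] V.nrm_eq_0_iff[OF that] zero by auto
  have inj: "inj_on \<iota> (carr V)"
  proof (rule inj_onI)
    fix u v assume *: "u \<in> carr V" "v \<in> carr V" "\<iota> u = \<iota> v"
    then have "\<iota> (u - v) = 0" using diff by simp
    then show "u = v" using eq_0[of "u - v"] * by simp
  qed
  have sub: "vsB.subspace (carr B)"
    unfolding carr
  proof (rule vsB.subspaceI)
    show "0 \<in> \<iota> ` carr V" using zero[symmetric] by blast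
    show "x + y \<in> \<iota> ` carr V" if "x \<in> \<iota> ` carr V" "y \<in> \<iota> ` carr V" for x y
      using that by (auto simp: add[symmetric])
    show "scl B c x \<in> \<iota> ` carr V" if "x \<in> \<iota> ` carr V" for c x
      using that by (auto simp: scl[symmetric])
  qed
  have normed: "complex_normed_space B"
    unfolding complex_normed_space_def
    using vs sub by (auto simp: carr nrm eq_0 scl[symmetric] add[symmetric] V.nrm_triangle)
  interpret B: cnorm_space B by unfold_locales (rule normed)
  have "B.ms.mcomplete"
    unfolding B.ms.mcomplete_def
  proof (intro allI impI)
    fix \<sigma> assume \<sigma>: "B.ms.MCauchy \<sigma>"
    then have "range \<sigma> \<subseteq> carr B" by (simp add: B.ms.MCauchy_def)
    then have "\<exists>u. u \<in> carr V \<and> \<sigma> n = \<iota> u" for n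
      unfolding carr by blast
    then obtain \<tau> where \<tau>: "\<And>n. \<tau> n \<in> carr V" "\<And>n. \<sigma> n = \<iota> (\<tau> n)" by metis
    have dist: "cdist B (\<iota> u) (\<iota> v) = nrm V (u - v)" if "u \<in> carr V" "v \<in> carr V" for u v
      using that by (simp add: cdist_def carr diff[symmetric] nrm)
    have Cauchy: "\<exists>M. \<forall>m\<ge>M. \<forall>n\<ge>M. nrm V (\<tau> m - \<tau> n) < e" if "0 < e" for e
      using \<sigma> that unfolding B.ms.MCauchy_def by (auto simp: \<tau> dist)
    obtain u where u: "u \<in> carr V" "(\<lambda>n. nrm V (\<tau> n - u)) \<longlonglongrightarrow> 0"
      by (rule V.Cauchy_limit[OF \<tau>(1) Cauchy])
    have "\<forall>\<^sub>F n in sequentially. \<sigma> n \<in> carr B \<and> cdist B (\<sigma> n) (\<iota> u) < e" if "0 < e" for e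
      using order_tendstoD(2)[OF u(2) that] by eventually_elim (use u(1) \<tau> in \<open>auto simp: dist carr\<close>)
    moreover have "\<iota> u \<in> carr B" using u(1) carr by blast
    ultimately have "limitin B.ms.mtopology \<sigma> (\<iota> u) sequentially"
      by (simp add: B.ms.limitin_metric)
    then show "\<exists>x. limitin B.ms.mtopology \<sigma> x sequentially" ..
  qed
  moreover have "uniformly_convex B"
    unfolding uniformly_convex_def
  proof (intro allI impI)
    fix e :: real assume "0 < e"
    then obtain \<delta> where "0 < \<delta>" "\<forall>f\<in>carr V. \<forall>g\<in>carr V.
        nrm V f = 1 \<and> nrm V g = 1 \<and> e \<le> nrm V (f - g) \<longrightarrow> nrm V (f + g) \<le> 2 - \<delta>"
      using V unfolding uniform_banach_space_def uniformly_convex_def by blast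
    then show "\<exists>\<delta>>0. \<forall>f\<in>carr B. \<forall>g\<in>carr B.
        nrm B f = 1 \<and> nrm B g = 1 \<and> e \<le> nrm B (f - g) \<longrightarrow> nrm B (f + g) \<le> 2 - \<delta>"
      by (intro exI[of _ \<delta>]) (auto simp: carr nrm add[symmetric] diff[symmetric])
  qed
  moreover have "uniformly_frechet_differentiable B"
  proof -
    obtain D where D: "uniform_limit (unit_sphere V \<times> unit_sphere V)
        (\<lambda>t::real. \<lambda>(f, g). (nrm V (f + scl V (of_real t) g) - nrm V f) / t) D (at 0)"
      using V.uniform_limit_nrm_quotient by blast
    let ?D = "\<lambda>(f, g). D (inv_into (carr V) \<iota> f, inv_into (carr V) \<iota> g)"
    have sphere: "unit_sphere B = \<iota> ` unit_sphere V"
      by (auto simp: unit_sphere_def carr nrm)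
    have "uniform_limit (unit_sphere B \<times> unit_sphere B)
        (\<lambda>t::real. \<lambda>(f, g). (nrm B (f + scl B (of_real t) g) - nrm B f) / t) ?D (at 0)"
    proof (rule uniform_limitI)
      fix e :: real assume "0 < e"
      from uniform_limitD[OF D this]
      show "\<forall>\<^sub>F t in at 0. \<forall>x\<in>unit_sphere B \<times> unit_sphere B.
          dist (case x of (f, g) \<Rightarrow> (nrm B (f + scl B (of_real t) g) - nrm B f) / t) (?D x) < e"
      proof eventually_elim
        case (elim t)
        have "dist ((nrm B (\<iota> u + scl B (of_real t) (\<iota> v)) - nrm B (\<iota> u)) / t) (?D (\<iota> u, \<iota> v)) < e"
          if "u \<in> unit_sphere V" "v \<in> unit_sphere V" for u v
          using bspec[OF elim, of "(u, v)"] that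
          by (simp add: unit_sphere_def inv_into_f_f[OF inj] scl[symmetric] add[symmetric] nrm)
        then show ?case by (auto simp: sphere)
      qed
    qed
    then show ?thesis unfolding uniformly_frechet_differentiable_def by blast
  qed
  ultimately show ?thesis
    unfolding uniform_banach_space_def complex_banach_space_def using normed by blast
qed

section \<open>The two implications between kernels and feature maps\<close>

lemma rkbs_imp_feature_representation:
  fixes B :: "('x \<Rightarrow> 'l::ab_group_add) cspace"
  assumes B: "rkbs X L B" and K: "is_reproducing_kernel X L B K"
  shows "feature_representation X L K B (\<lambda>x f. f x)"
proof -
  have uB: "uniform_banach_space B" and uL: "uniform_banach_space L"
    and fun_B: "banach_space_of_functions X L B"
    using B by (auto simp: rkbs_def)
  interpret B: unif_space B using uB by (simp add: unif_space_iff)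
  interpret L: unif_space L using uL by (simp add: unif_space_iff)
  have value_carr: "f x \<in> carr L" if "f \<in> carr B" "x \<in> X" for f x
    using fun_B that by (auto simp: banach_space_of_functions_def)
  have off: "f x = 0" if "f \<in> carr B" "x \<notin> X" for f x
    using fun_B that by (auto simp: banach_space_of_functions_def)
  have eval: "(\<lambda>f. f x) \<in> bdd_lin_maps B L" if "x \<in> X" for x
    using that B fun_B
    by (intro continuous_linear_imp_bounded B.complex_normed L.complex_normed)
      (auto simp: rkbs_def banach_space_of_functions_def)
  have sec: "kernel_section X K x \<xi> \<in> carr B"
    and rep: "f \<in> carr B \<Longrightarrow> sip L (f x) \<xi> = sip B f (kernel_section X K x \<xi>)"
    if "x \<in> X" "\<xi> \<in> carr L" for f x \<xi>
    using K that by (auto simp: is_reproducing_kernel_def)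
  have adj: "gen_adjoint B L (\<lambda>f. f x) \<xi> = kernel_section X K x \<xi>"
    if "x \<in> X" "\<xi> \<in> carr L" for x \<xi>
    by (rule gen_adjoint_eqI[OF uB sec[OF that] rep[OF that]])
  have "closed_span (dual_space B)
      {duality_map B (gen_adjoint B L (\<lambda>f. f x) \<xi>) | x \<xi>. x \<in> X \<and> \<xi> \<in> carr L}
      = carr (dual_space B)"
  proof (rule B.closed_span_dual_eq_carr)
    show "{duality_map B (gen_adjoint B L (\<lambda>f. f x) \<xi>) | x \<xi>. x \<in> X \<and> \<xi> \<in> carr L}
        \<subseteq> carr (dual_space B)"
      by (auto simp: adj intro!: B.duality_map_in_dual sec)
    fix f
    assume f: "f \<in> carr B"
      and zero: "\<And>s. s \<in> {duality_map B (gen_adjoint B L (\<lambda>f. f x) \<xi>) | x \<xi>. x \<in> X \<and> \<xi> \<in> carr L}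
        \<Longrightarrow> s f = 0"
    have "f x = 0" for x
    proof (cases "x \<in> X")
      case True
      \<comment> \<open>Choosing the value \<open>f x\<close> itself as \<open>\<xi>\<close> gives
        \<open>[f x, f x] = 0\<close>.\<close>
      have "duality_map B (gen_adjoint B L (\<lambda>f. f x) (f x)) f = 0"
        by (rule zero) (use True value_carr[OF f True] in blast)
      then have "sip L (f x) (f x) = 0"
        using f rep[OF True value_carr[OF f True] f] adj[OF True value_carr[OF f True]]
        by (simp add: duality_map_def)
      then show ?thesis
        using L.sip_self[OF value_carr[OF f True]] value_carr[OF f True] by simp
    qed (use f off in blast)
    then show "f = 0" by (simp add: fun_eq_iff)
  qed
  moreover have "K x y \<xi> = gen_adjoint B L (\<lambda>f. f x) \<xi> y"
    if "x \<in> X" "y \<in> X" "\<xi> \<in> carr L" for x y \<xi>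
    using that by (simp add: adj kernel_section_def)
  ultimately show ?thesis
    unfolding feature_representation_def using uB eval by blast
qed

lemma feature_representation_imp_rkbs:
  fixes L :: "('l::ab_group_add) cspace"
  assumes uL: "uniform_banach_space L"
    and K: "\<And>x y. x \<in> X \<Longrightarrow> y \<in> X \<Longrightarrow> K x y \<in> bdd_maps L L"
    and feature: "feature_representation X L K W \<Phi>"
  shows "\<exists>B. rkbs X L B \<and> is_reproducing_kernel X L B K"
proof -
  have uW: "uniform_banach_space W"
    and \<Phi>: "\<And>x. x \<in> X \<Longrightarrow> \<Phi> x \<in> bdd_lin_maps W L"
    and K_eq: "\<And>x y \<xi>. x \<in> X \<Longrightarrow> y \<in> X \<Longrightarrow> \<xi> \<in> carr L \<Longrightarrow>
      K x y \<xi> = \<Phi> y (gen_adjoint W L (\<Phi> x) \<xi>)"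
    and dense: "closed_span (dual_space W)
      {duality_map W (gen_adjoint W L (\<Phi> x) \<xi>) | x \<xi>. x \<in> X \<and> \<xi> \<in> carr L}
      = carr (dual_space W)"
    using feature by (auto simp: feature_representation_def)
  interpret W: unif_space W using uW by (simp add: unif_space_iff)
  interpret L: unif_space L using uL by (simp add: unif_space_iff)
  note adj_carr = gen_adjoint_characterization(1)[OF uW uL \<Phi>]
  note adj_eq = gen_adjoint_characterization(2)[OF uW uL \<Phi>]
  have \<Phi>_carr: "\<Phi> x u \<in> carr L" if "x \<in> X" "u \<in> carr W" for x u
    using \<Phi>[OF that(1)] that(2) by (auto simp: bdd_lin_maps_def bdd_maps_def)
  have \<Phi>_add: "\<Phi> x (u + v) = \<Phi> x u + \<Phi> x v" if "x \<in> X" "u \<in> carr W" "v \<in> carr W" for x u v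
    using \<Phi>[OF that(1)] that by (auto simp: bdd_lin_maps_def)
  have \<Phi>_scl: "\<Phi> x (scl W a u) = scl L a (\<Phi> x u)" if "x \<in> X" "u \<in> carr W" for x a u
    using \<Phi>[OF that(1)] that by (auto simp: bdd_lin_maps_def)
  define \<iota> where "\<iota> u = (\<lambda>x. if x \<in> X then \<Phi> x u else 0)" for u
  have \<iota>_add: "\<iota> (u + v) = \<iota> u + \<iota> v" if "u \<in> carr W" "v \<in> carr W" for u v
    using that by (auto simp: \<iota>_def fun_eq_iff \<Phi>_add)
  have \<iota>_scl: "\<iota> (scl W a u) = (\<lambda>x. scl L a (\<iota> u x))" if "u \<in> carr W" for a u
    using that by (auto simp: \<iota>_def fun_eq_iff \<Phi>_scl)
  \<comment> \<open>This is where the density condition is used.\<close>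
  have \<iota>_eq_0: "u = 0" if u: "u \<in> carr W" and "\<iota> u = 0" for u
  proof -
    have \<Phi>_zero: "\<Phi> x u = 0" if "x \<in> X" for x
      using fun_cong[OF \<open>\<iota> u = 0\<close>, of x] that by (simp add: \<iota>_def)
    \<comment> \<open>All functionals of the spanning set vanish at \<open>u\<close>, hence so does
      the functional of \<open>u\<close> itself, whose value there is the squared norm.\<close>
    have "duality_map W u u = 0"
    proof (rule W.closed_span_dual_separates[OF dense _ u _ W.duality_map_in_dual[OF u]])
      show "{duality_map W (gen_adjoint W L (\<Phi> x) \<xi>) | x \<xi>. x \<in> X \<and> \<xi> \<in> carr L}
          \<subseteq> carr (dual_space W)"
        by (auto intro!: W.duality_map_in_dual adj_carr)
      show "s u = 0" if "s \<in> {duality_map W (gen_adjoint W L (\<Phi> x) \<xi>) | x \<xi>. x \<in> X \<and> \<xi> \<in> carr L}" for s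
        using that u by (auto simp: duality_map_def adj_eq \<Phi>_zero L.csip_zero_left[OF L.compatible_sip_sip])
    qed
    then show ?thesis using W.sip_self[OF u] u by (simp add: duality_map_def)
  qed
  have inj: "inj_on \<iota> (carr W)"
  proof (rule inj_onI)
    fix u v assume *: "u \<in> carr W" "v \<in> carr W" "\<iota> u = \<iota> v"
    then have "\<iota> (u - v) + \<iota> v = 0 + \<iota> v"
      using \<iota>_add[of "u - v" v] by simp
    then have "\<iota> (u - v) = 0" by (simp only: add_right_cancel)
    then show "u = v" using \<iota>_eq_0[of "u - v"] * by simp
  qed
  \<comment> \<open>The norm is pulled back along the inverse of \<open>\<iota>\<close>, so
    injectivity makes \<open>\<iota>\<close> an isometry; operations remain pointwise.\<close>
  define B where "B = \<lparr>carr = \<iota> ` carr W, scl = \<lambda>a f x. scl L a (f x),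
    nrm = \<lambda>f. nrm W (inv_into (carr W) \<iota> f)\<rparr>"
  have carr_B: "carr B = \<iota> ` carr W" and scl_B: "scl B = (\<lambda>a f x. scl L a (f x))"
    by (auto simp: B_def)
  have nrm_B: "nrm B (\<iota> u) = nrm W u" if "u \<in> carr W" for u
    using that by (simp add: B_def inv_into_f_f[OF inj])
  have vs_B: "vector_space (scl B)"
    unfolding scl_B
    by unfold_locales (auto simp: fun_eq_iff L.vs.scale_right_distrib L.vs.scale_left_distrib)
  have uB: "uniform_banach_space B"
    by (rule uniform_banach_space_isometric_image[OF uW vs_B carr_B \<iota>_add _ nrm_B])
      (auto simp: scl_B \<iota>_scl)
  interpret B: unif_space B using uB by (simp add: unif_space_iff)
  have fun_B: "banach_space_of_functions X L B"
    unfolding banach_space_of_functions_def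
  proof (intro conjI ballI)
    show "complex_banach_space B" using uB by (simp add: uniform_banach_space_def)
    show "scl B = (\<lambda>a f x. scl L a (f x))" by (rule scl_B)
    fix f assume f: "f \<in> carr B"
    then show "\<And>x. x \<in> X \<Longrightarrow> f x \<in> carr L" and off: "\<forall>x. x \<notin> X \<longrightarrow> f x = 0"
      by (auto simp: carr_B \<iota>_def \<Phi>_carr)
    show "nrm B f = 0 \<longleftrightarrow> (\<forall>x\<in>X. f x = 0)"
      using B.nrm_eq_0_iff[OF f] off by (auto simp: fun_eq_iff)
  qed
  have eval: "(\<lambda>f. f x) \<in> bdd_lin_maps B L" if x: "x \<in> X" for x
  proof -
    obtain \<alpha> where "0 \<le> \<alpha>" "\<And>u. u \<in> carr W \<Longrightarrow> nrm L (\<Phi> x u) \<le> \<alpha> * nrm W u"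
      using \<Phi>[OF x] by (auto simp: bdd_lin_maps_def bdd_maps_def)
    then have "\<exists>\<alpha>\<ge>0. \<forall>f\<in>carr B. nrm L (f x) \<le> \<alpha> * nrm B f"
      using x by (intro exI[of _ \<alpha>]) (auto simp: carr_B nrm_B, simp add: \<iota>_def)
    then show ?thesis
      using x by (auto simp: bdd_lin_maps_def bdd_maps_def scl_B carr_B \<iota>_def \<Phi>_carr)
  qed
  have rkbs: "rkbs X L B"
    unfolding rkbs_def using fun_B uB uL eval
    by (auto intro!: bdd_lin_maps_imp_continuous B.complex_normed L.complex_normed)
  \<comment> \<open>The chosen \<open>sip B\<close> becomes accessible by showing that the
    transported form is compatible with the norm of \<open>B\<close> and invoking
    uniqueness.\<close>
  have sip_B: "sip B (\<iota> u) (\<iota> v) = sip W u v" if "u \<in> carr W" "v \<in> carr W" for u v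
  proof -
    let ?s = "\<lambda>f g. sip W (inv_into (carr W) \<iota> f) (inv_into (carr W) \<iota> g)"
    have "compatible_sip B ?s"
      unfolding compatible_sip_def semi_inner_product_def
    proof (intro conjI ballI allI impI)
      fix f g h assume "f \<in> carr B" "g \<in> carr B" "h \<in> carr B"
      then show "?s (f + g) h = ?s f h + ?s g h"
        by (auto simp: carr_B \<iota>_add[symmetric] inv_into_f_f[OF inj] W.sip_add_left)
    next
      fix a f g assume "f \<in> carr B" "g \<in> carr B"
      then show "?s (scl B a f) g = a * ?s f g" "?s f (scl B a g) = cnj a * ?s f g"
        by (auto simp: carr_B scl_B \<iota>_scl[symmetric] inv_into_f_f[OF inj] W.sip_scl_left W.sip_scl_right)
    next
      fix f assume f: "f \<in> carr B" "f \<noteq> 0"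
      then obtain u where u: "u \<in> carr W" "f = \<iota> u" by (auto simp: carr_B)
      have "0 < nrm W u" using B.nrm_pos[OF f] u nrm_B by simp
      then show "?s f f \<in> \<real>" "0 < Re (?s f f)"
        using u by (auto simp: inv_into_f_f[OF inj] W.sip_self)
    next
      fix f g assume "f \<in> carr B" "g \<in> carr B"
      then show "cmod (?s f g) \<le> sqrt (Re (?s f f)) * sqrt (Re (?s g g))"
        by (auto simp: carr_B inv_into_f_f[OF inj] W.sip_self W.sip_cauchy_schwarz)
    next
      fix f assume "f \<in> carr B"
      then show "sqrt (Re (?s f f)) = nrm B f"
        by (auto simp: carr_B inv_into_f_f[OF inj] W.sip_self nrm_B)
    qed
    from B.csip_unique[OF this, of "\<iota> v" "\<iota> u"] show ?thesis
      using that by (simp add: carr_B inv_into_f_f[OF inj])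
  qed
  \<comment> \<open>Kernel sections are the images of the adjoint vectors, so the reproducing
    property becomes the defining identity of the generalized adjoint.\<close>
  have sec: "kernel_section X K x \<xi> = \<iota> (gen_adjoint W L (\<Phi> x) \<xi>)"
    if "x \<in> X" "\<xi> \<in> carr L" for x \<xi>
    using that by (auto simp: kernel_section_def \<iota>_def K_eq fun_eq_iff)
  have "is_reproducing_kernel X L B K"
    unfolding is_reproducing_kernel_def
  proof (intro conjI ballI)
    fix x \<xi> assume x: "x \<in> X" and \<xi>: "\<xi> \<in> carr L"
    show "kernel_section X K x \<xi> \<in> carr B"
      by (simp add: sec x \<xi> carr_B adj_carr)
  next
    fix f x \<xi> assume f: "f \<in> carr B" and x: "x \<in> X" and \<xi>: "\<xi> \<in> carr L"
    obtain u where u: "u \<in> carr W" "f = \<iota> u" using f by (auto simp: carr_B)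
    have "sip B f (kernel_section X K x \<xi>) = sip L (\<Phi> x u) \<xi>"
      by (simp add: sec u x \<xi> sip_B adj_carr adj_eq)
    then show "sip L (f x) \<xi> = sip B f (kernel_section X K x \<xi>)"
      using u x by (simp add: \<iota>_def)
  qed (rule K)
  with rkbs show ?thesis by blast
qed

(* HOL cannot quantify existentially over types. The space W is therefore sought in the type
   'x => 'l in the equivalence, which makes the forward implication as strong as possible, and
   the second conjunct extends the converse to spaces W over an arbitrary type 'w. *)
theorem theorem3p1:
  fixes X :: "'x set"
    and L :: "('l::ab_group_add) cspace"
    and K :: "'x \<Rightarrow> 'x \<Rightarrow> 'l \<Rightarrow> 'l"
  assumes "uniform_banach_space L"
    and "\<And>x y. x \<in> X \<Longrightarrow> y \<in> X \<Longrightarrow> K x y \<in> bdd_maps L L"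
  shows "((\<exists>B. rkbs X L B \<and> is_reproducing_kernel X L B K) \<longleftrightarrow>
            (\<exists>(W :: ('x \<Rightarrow> 'l) cspace) \<Phi>. feature_representation X L K W \<Phi>)) \<and>
         ((\<exists>(W :: ('w::ab_group_add) cspace) \<Phi>. feature_representation X L K W \<Phi>) \<longrightarrow>
            (\<exists>B. rkbs X L B \<and> is_reproducing_kernel X L B K))"
proof -
  have "\<exists>(W :: ('x \<Rightarrow> 'l) cspace) \<Phi>. feature_representation X L K W \<Phi>"
    if "\<exists>B. rkbs X L B \<and> is_reproducing_kernel X L B K"
    using that by (blast intro: rkbs_imp_feature_representation)
  moreover have "\<exists>B. rkbs X L B \<and> is_reproducing_kernel X L B K"
    if "\<exists>(W :: ('x \<Rightarrow> 'l) cspace) \<Phi>. feature_representation X L K W \<Phi>"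
    using that by (elim exE) (rule feature_representation_imp_rkbs[OF assms])
  moreover have "\<exists>B. rkbs X L B \<and> is_reproducing_kernel X L B K"
    if "\<exists>(W :: 'w cspace) \<Phi>. feature_representation X L K W \<Phi>"
    using that by (elim exE) (rule feature_representation_imp_rkbs[OF assms])
  ultimately show ?thesis by blast
qed

end
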